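(* Let $g \geq 2$, let $F$ be the free group on $a_1,\dots,a_{2g}$, let $w = [a_1,a_2]\cdots[a_{2g-1},a_{2g}]$, and let $\langle\langle w\rangle\rangle_F$ be the normal closure of $w$ in $F$ (so $\Gamma_g = F/\langle\langle w\rangle\rangle_F$ is the genus $g$ surface group). Let $N$ be a normal subgroup of $F$ such that $G = F/N$ satisfies $G/\gamma_k(G) \cong \Gamma_g/\gamma_k(\Gamma_g)$ for all $k \geq 1$. (i) If there is an automorphism $\phi$ of $F$ with $\phi(N) \supseteq \langle\langle w\rangle\rangle_F$, then $G \cong \Gamma_g$. (ii) If there is an automorphism $\phi$ of $F$ with $\phi(N)$ a proper subgroup of $\langle\langle w\rangle\rangle_F$, then $G$ is not residually nilpotent.
   Context: $\gamma_k$ denotes the lower central series: $\gamma_1(G)=G$, $\gamma_k(G)=[G,\gamma_{k-1}(G)]$. $[x,y]$ denotes the commutator. A group is residually nilpotent if the intersection of all $\gamma_k(G)$ is trivial. *)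

theory Defs
  imports "HOL-Algebra.Algebra"
begin

text \<open>A letter (i, True) stands for the generator a_(i+1), (i, False) for its inverse.
  Elements of the free group are freely reduced words.\<close>

type_synonym fword = "(nat \<times> bool) list"

fun freduce :: "fword \<Rightarrow> fword" where
  "freduce [] = []"
| "freduce (x # xs) =
     (case freduce xs of
        [] \<Rightarrow> [x]
      | y # ys \<Rightarrow> (if fst x = fst y \<and> snd x \<noteq> snd y then ys else x # y # ys))"

fun freduced :: "fword \<Rightarrow> bool" where
  "freduced [] = True"
| "freduced [x] = True"
| "freduced (x # y # ys) = (\<not> (fst x = fst y \<and> snd x \<noteq> snd y) \<and> freduced (y # ys))"

definition free_group :: "nat \<Rightarrow> fword monoid" where
  "free_group n = \<lparr> carrier = {w. freduced w \<and> (\<forall>x\<in>set w. fst x < n)},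
                    monoid.mult = (\<lambda>u v. freduce (u @ v)),
                    one = [] \<rparr>"

definition fgen :: "nat \<Rightarrow> fword" where
  "fgen i = [(i, True)]"

text \<open>Commutator convention [x,y] = x y x^-1 y^-1 (as in HOL-Algebra's derived subgroup).\<close>

definition comm :: "('a, 'b) monoid_scheme \<Rightarrow> 'a \<Rightarrow> 'a \<Rightarrow> 'a" where
  "comm G x y = x \<otimes>\<^bsub>G\<^esub> y \<otimes>\<^bsub>G\<^esub> inv\<^bsub>G\<^esub> x \<otimes>\<^bsub>G\<^esub> inv\<^bsub>G\<^esub> y"

definition normal_closure :: "('a, 'b) monoid_scheme \<Rightarrow> 'a set \<Rightarrow> 'a set" where
  "normal_closure G S =
     generate G (\<Union>h\<in>carrier G. (\<lambda>s. h \<otimes>\<^bsub>G\<^esub> s \<otimes>\<^bsub>G\<^esub> inv\<^bsub>G\<^esub> h) ` S)"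

text \<open>Lower central series, indexed as in the paper: lcs G 1 = G,
  lcs G (k+1) = [G, lcs G k]. (lcs G 0 is set to G as a dummy value.)\<close>

fun lcs :: "('a, 'b) monoid_scheme \<Rightarrow> nat \<Rightarrow> 'a set" where
  "lcs G 0 = carrier G"
| "lcs G (Suc 0) = carrier G"
| "lcs G (Suc (Suc k)) =
     generate G (\<Union>x\<in>carrier G. \<Union>y\<in>lcs G (Suc k). {comm G x y})"

definition residually_nilpotent :: "('a, 'b) monoid_scheme \<Rightarrow> bool" where
  "residually_nilpotent G \<longleftrightarrow> (\<Inter>k\<in>{1..}. lcs G k) = {\<one>\<^bsub>G\<^esub>}"

text \<open>w = [a_1,a_2] ... [a_(2g-1),a_(2g)], with a_(i+1) = fgen i.\<close>

definition surface_word :: "nat \<Rightarrow> fword" where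
  "surface_word g =
     foldr (\<lambda>j acc. comm (free_group (2*g)) (fgen (2*j)) (fgen (2*j+1))
                     \<otimes>\<^bsub>free_group (2*g)\<^esub> acc) [0..<g] \<one>\<^bsub>free_group (2*g)\<^esub>"

end

theory Submission
  imports Defs Complex_Main
begin

text \<open>
  Write \<open>\<Gamma>\<close> for the surface group. In both cases \<open>\<phi>\<close> makes one of \<open>G\<close> and \<open>\<Gamma>\<close> a quotient of the
  other. The induced epimorphism between the quotients by the \<open>k\<close>-th terms of the lower central
  series is an isomorphism, since finitely generated nilpotent groups satisfy the ascending chain
  condition on subgroups and hence are Hopfian. So its kernel lies in every term of the lower
  central series. In (ii) this kernel is a nontrivial subgroup of \<open>G\<close>; in (i) it is a subgroup of
  \<open>\<Gamma>\<close>, and it is trivial because \<open>\<Gamma>\<close> is residually nilpotent.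

  For the residual nilpotence, \<open>\<Gamma>\<close> embeds into the genus two surface group, as the group of a cyclic
  cover. The latter is the amalgam of two free groups of rank two along a commutator. Represent both
  factors by Sanov's free group of matrices congruent to the identity modulo 2, in which the
  commutator becomes a hyperbolic matrix \<open>U\<close>, and twist the second factor by \<open>U ^ n\<close>. A nontrivial
  alternating product has a nontrivial image for large \<open>n\<close>, and the congruence subgroups modulo
  powers of 2 form a central filtration with trivial intersection.
\<close>

section \<open>Lower central series and chains of subgroups\<close>

text \<open>Genus two is singled out because its relation reads
  \<open>[a_1,a_2] = [a_4,a_3]\<close>: just two free groups of rank two, glued along one cyclic
  subgroup. A cover of degree g - 1 multiplies the Euler characteristic -2 by g - 1, so it has genus
  g. Identifying the two factors of the amalgam maps it to a single free group, but this folding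
  kills every quotient of corresponding elements. Combining it with powers of the Dehn twist along
  the gluing curve, which conjugates the second factor by \<open>U ^ n\<close>, repairs this: all
  \<open>n\<close> together detect every element. The matrices provide a faithful model of the free
  group, a hyperbolic twist whose growth is measured along two eigenlines, and a filtration modulo
  powers of 2. Growth requires that factors outside the amalgamated subgroup preserve neither
  eigenline. The eigenlines are conjugate over the field generated by \<open>sqrt 5\<close>, and the
  elements preserving them are found by solving the Pell equation
  \<open>P * P - 5 * Q * Q = 1\<close>.\<close>

context group
begin

lemma mult_inv_cancel_left [simp]:
  assumes "x \<in> carrier G" "y \<in> carrier G"
  shows "x \<otimes> (inv x \<otimes> y) = y" "inv x \<otimes> (x \<otimes> y) = y"
  using assms by (simp_all add: m_assoc [symmetric])

lemma comm_closed [simp]: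
  "\<lbrakk>x \<in> carrier G; y \<in> carrier G\<rbrakk> \<Longrightarrow> comm G x y \<in> carrier G"
  by (simp add: comm_def)

lemma inv_commutator:
  "\<lbrakk>x \<in> carrier G; y \<in> carrier G\<rbrakk> \<Longrightarrow> inv (comm G x y) = comm G y x"
  by (simp add: comm_def inv_mult_group m_assoc)

lemma comm_mult_left:
  "\<lbrakk>x \<in> carrier G; x' \<in> carrier G; y \<in> carrier G\<rbrakk>
    \<Longrightarrow> comm G (x \<otimes> x') y = x \<otimes> comm G x' y \<otimes> inv x \<otimes> comm G x y"
  by (simp add: comm_def inv_mult_group m_assoc)

lemma comm_mult_right:
  "\<lbrakk>x \<in> carrier G; y \<in> carrier G; y' \<in> carrier G\<rbrakk>
    \<Longrightarrow> comm G x (y \<otimes> y') = comm G x y \<otimes> (y \<otimes> comm G x y' \<otimes> inv y)"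
  by (simp add: comm_def inv_mult_group m_assoc)

lemma comm_inv_left:
  "\<lbrakk>x \<in> carrier G; y \<in> carrier G\<rbrakk> \<Longrightarrow> comm G (inv x) y = inv x \<otimes> inv (comm G x y) \<otimes> x"
  by (simp add: comm_def inv_mult_group m_assoc)

lemma comm_inv_right:
  "\<lbrakk>x \<in> carrier G; y \<in> carrier G\<rbrakk> \<Longrightarrow> comm G x (inv y) = inv y \<otimes> inv (comm G x y) \<otimes> y"
  by (simp add: comm_def inv_mult_group m_assoc)

lemma comm_conj:
  "\<lbrakk>g \<in> carrier G; x \<in> carrier G; y \<in> carrier G\<rbrakk>
    \<Longrightarrow> g \<otimes> comm G x y \<otimes> inv g = comm G (g \<otimes> x \<otimes> inv g) (g \<otimes> y \<otimes> inv g)"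
  by (simp add: comm_def inv_mult_group m_assoc)

end

lemma hom_comm:
  assumes "group G" "group H" "h \<in> hom G H" "x \<in> carrier G" "y \<in> carrier G"
  shows "h (comm G x y) = comm H (h x) (h y)"
proof -
  interpret group_hom G H h
    using assms by (simp add: group_hom_def group_hom_axioms_def)
  show ?thesis using assms by (simp add: comm_def)
qed

context group
begin

lemma lcs_normal: "lcs G k \<lhd> G"
proof (induction k rule: induct_nat_012)
  case (ge2 k)
  let ?S = "\<Union>x\<in>carrier G. \<Union>y\<in>lcs G (Suc k). {comm G x y}"
  have nk: "lcs G (Suc k) \<lhd> G" using ge2(2) .
  have sub: "lcs G (Suc k) \<subseteq> carrier G"
    using nk normal_imp_subgroup subgroup.subset by blast
  have "generate G ?S \<lhd> G"
  proof (rule normal_generateI)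
    show "?S \<subseteq> carrier G" using sub by auto
    fix h g assume "h \<in> ?S" and g: "g \<in> carrier G"
    then obtain x y where xy: "x \<in> carrier G" "y \<in> lcs G (Suc k)" "h = comm G x y" by auto
    moreover have "g \<otimes> y \<otimes> inv g \<in> lcs G (Suc k)"
      using nk xy(2) g by (meson normal.inv_op_closed2)
    moreover have "g \<otimes> h \<otimes> inv g = comm G (g \<otimes> x \<otimes> inv g) (g \<otimes> y \<otimes> inv g)"
      using g xy sub by (simp add: comm_conj subsetD del: lcs.simps)
    moreover have "g \<otimes> x \<otimes> inv g \<in> carrier G" using g xy by simp
    ultimately show "g \<otimes> h \<otimes> inv g \<in> ?S" by blast
  qed
  then show ?case by simp
qed (simp_all add: normal_self)

lemma lcs_subgroup: "subgroup (lcs G k) G"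
  using lcs_normal normal_imp_subgroup by blast

lemma lcs_carrier: "x \<in> lcs G k \<Longrightarrow> x \<in> carrier G"
  by (rule subgroup.mem_carrier[OF lcs_subgroup])

lemma comm_in_lcs_Suc:
  assumes "x \<in> carrier G" "y \<in> lcs G k"
  shows "comm G x y \<in> lcs G (Suc k)"
  using assms lcs_carrier by (cases k) (auto intro!: generate.incl)

text \<open>Used with \<open>M k\<close> the preimage of a congruence subgroup modulo
  \<open>2 ^ k\<close>, it turns membership in the lower central series into a congruence of
  matrices.\<close>

lemma lcs_le_filtration:
  assumes sub: "\<And>k. subgroup (M k) G"
    and one: "carrier G \<subseteq> M 1"
    and step: "\<And>k x y. \<lbrakk>k \<ge> 1; x \<in> carrier G; y \<in> M k\<rbrakk> \<Longrightarrow> comm G x y \<in> M (Suc k)"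
    and "k \<ge> 1"
  shows "lcs G k \<subseteq> M k"
  using \<open>k \<ge> 1\<close>
proof (induction k rule: dec_induct)
  case base
  then show ?case using one by simp
next
  case (step n)
  then obtain m where n: "n = Suc m" by (cases n) auto
  have "(\<Union>x\<in>carrier G. \<Union>y\<in>lcs G (Suc m). {comm G x y}) \<subseteq> M (Suc (Suc m))"
    using step n assms(3)[of n] by auto
  then show ?case
    using n generate_subgroup_incl[OF _ sub] by simp
qed

end

lemma lcs_hom_image:
  assumes "group G" "group H" "h \<in> hom G H" "h ` carrier G = carrier H"
  shows "h ` lcs G k = lcs H k"
proof (induction k rule: induct_nat_012)
  case (ge2 k)
  interpret group_hom G H h
    using assms by (simp add: group_hom_def group_hom_axioms_def)
  let ?S = "\<Union>x\<in>carrier G. \<Union>y\<in>lcs G (Suc k). {comm G x y}"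
  have "?S \<subseteq> carrier G" using G.lcs_carrier by auto
  then have "h ` lcs G (Suc (Suc k)) = generate H (h ` ?S)"
    using generate_img by simp
  also have "h ` ?S = (\<Union>x\<in>carrier G. \<Union>y\<in>lcs G (Suc k). {comm H (h x) (h y)})"
    using G.lcs_carrier by (simp add: image_UN hom_comm[OF assms(1-3)])
  also have "\<dots> = (\<Union>x\<in>carrier H. \<Union>y\<in>lcs H (Suc k). {comm H x y})"
    unfolding ge2(2)[symmetric] assms(4)[symmetric] by blast
  finally show ?case by simp
qed (use assms in simp_all)

text \<open>The bound \<open>B\<close> may be any set, and the chains consist of subgroups of the
  ambient \<open>G\<close>. So the condition can be passed along the lower central series without
  turning its terms into groups of their own.\<close>

definition acc_subgroups :: "('a, 'b) monoid_scheme \<Rightarrow> 'a set \<Rightarrow> bool" where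
  "acc_subgroups G B \<longleftrightarrow>
     (\<forall>H :: nat \<Rightarrow> 'a set. (\<forall>i. subgroup (H i) G \<and> H i \<subseteq> B \<and> H i \<subseteq> H (Suc i))
        \<longrightarrow> (\<exists>i. \<forall>j\<ge>i. H j = H i))"

lemma acc_subgroups_mono: "acc_subgroups G B \<Longrightarrow> A \<subseteq> B \<Longrightarrow> acc_subgroups G A"
  unfolding acc_subgroups_def by (erule all_forward) (auto dest: subset_trans)

text \<open>The union of the chain is an ideal of the integers. If it is nonzero, a member that
  contains its least positive element \<open>d\<close> contains the whole union, by division with
  remainder.\<close>

lemma int_subgroup_chain_stable:
  fixes I :: "nat \<Rightarrow> int set"
  assumes zero: "\<And>i. 0 \<in> I i"
    and diff: "\<And>i m n. m \<in> I i \<Longrightarrow> n \<in> I i \<Longrightarrow> m - n \<in> I i"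
    and mono: "\<And>i. I i \<subseteq> I (Suc i)"
  shows "\<exists>i. \<forall>j\<ge>i. I j = I i"
proof -
  have le: "I i \<subseteq> I j" if "i \<le> j" for i j
    using that by (rule lift_Suc_mono_le[of I, OF mono])
  have neg: "- m \<in> I i" if "m \<in> I i" for m i
    using diff[OF zero that] by simp
  have add: "m + n \<in> I i" if "m \<in> I i" "n \<in> I i" for m n i
    using diff[OF that(1) neg[OF that(2)]] by simp
  have multn: "int k * m \<in> I i" if "m \<in> I i" for m k i
    by (induction k) (use zero add that in \<open>auto simp: algebra_simps\<close>)
  have mult: "q * m \<in> I i" if "m \<in> I i" for m q i
  proof (cases "q \<ge> 0")
    case True
    then show ?thesis using multn[OF that, of "nat q"] by simp
  next
    case False
    then show ?thesis using neg[OF multn[OF that, of "nat (- q)"]] by simp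
  qed
  show ?thesis
  proof (cases "\<exists>n>0. \<exists>i. int n \<in> I i")
    case False
    have "m = 0" if "m \<in> I i" for m i
    proof (rule ccontr)
      assume "m \<noteq> 0"
      have "int (nat \<bar>m\<bar>) \<in> I i" using that neg[OF that] by (cases "m \<ge> 0") auto
      then show False using False \<open>m \<noteq> 0\<close> by (meson zero_less_abs_iff zero_less_nat_eq)
    qed
    then have "I i = {0}" for i using zero by auto
    then show ?thesis by auto
  next
    case True
    define d where "d = (LEAST n. n > 0 \<and> (\<exists>i. int n \<in> I i))"
    have d: "d > 0" "\<exists>i. int d \<in> I i"
      using LeastI_ex[OF True] by (auto simp: d_def)
    have dmin: "d \<le> n" if "n > 0" "int n \<in> I i" for n i
      unfolding d_def using that by (intro Least_le) auto
    from d obtain i where i: "int d \<in> I i" by blast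
    have "I j \<subseteq> I i" for j
    proof
      fix m assume m: "m \<in> I j"
      define l where "l = max i j"
      have "m \<in> I l" "int d \<in> I l" using m i le[of j l] le[of i l] by (auto simp: l_def)
      then have "m - (m div int d) * int d \<in> I l" using diff mult by blast
      then have "int (nat (m mod int d)) \<in> I l"
        using d(1) by (simp add: minus_div_mult_eq_mod)
      then have "nat (m mod int d) = 0"
        using dmin[of "nat (m mod int d)" l] d(1) pos_mod_bound[of "int d" m] by linarith
      then have "m mod int d = 0" using d(1) by (metis nat_0_iff of_nat_0_less_iff order_antisym pos_mod_sign)
      then have "m = (m div int d) * int d" by (simp add: mult_div_mod_eq[symmetric] dvd_imp_mod_0 mod_0_imp_dvd)
      then show "m \<in> I i" using mult[OF i] by metis
    qed
    then show ?thesis using le by blast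
  qed
qed

context group
begin

text \<open>A subgroup inside \<open>B\<close> is controlled by the exponents of \<open>x\<close>
  occurring in it and by its intersection with \<open>A\<close>. If two nested subgroups agree in
  both, then an element of the larger one differs from one of the smaller with the same exponent by
  an element of the common intersection.\<close>

lemma acc_subgroups_cyclic_extension:
  assumes A: "A \<lhd> G" and acc: "acc_subgroups G A" and x: "x \<in> carrier G"
    and B: "B \<subseteq> {x [^] (m::int) \<otimes> a | m a. a \<in> A}"
  shows "acc_subgroups G B"
  unfolding acc_subgroups_def
proof (intro allI impI)
  fix H :: "nat \<Rightarrow> 'a set"
  assume H: "\<forall>i. subgroup (H i) G \<and> H i \<subseteq> B \<and> H i \<subseteq> H (Suc i)"
  interpret A: normal A G by fact
  have Hs: "subgroup (H i) G" and Hmono: "H i \<subseteq> H (Suc i)" and HB: "H i \<subseteq> B" for i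
    using H by auto
  define I where "I i = {m::int. \<exists>a\<in>A. x [^] m \<otimes> a \<in> H i}" for i
  have "\<exists>i. \<forall>j\<ge>i. I j = I i"
  proof (rule int_subgroup_chain_stable)
    show "0 \<in> I i" for i
      unfolding I_def using subgroup.one_closed[OF Hs] A.one_closed by (auto intro!: bexI[of _ \<one>])
    show "I i \<subseteq> I (Suc i)" for i unfolding I_def using Hmono by blast
    fix i m n assume "m \<in> I i" "n \<in> I i"
    then obtain a b where ab: "a \<in> A" "b \<in> A" "x [^] m \<otimes> a \<in> H i" "x [^] n \<otimes> b \<in> H i"
      unfolding I_def by auto
    have c: "a \<in> carrier G" "b \<in> carrier G" using ab by auto
    have "(x [^] m \<otimes> a) \<otimes> inv (x [^] n \<otimes> b) \<in> H i"
      using ab Hs by (meson subgroup.m_closed subgroup.m_inv_closed)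
    also have "(x [^] m \<otimes> a) \<otimes> inv (x [^] n \<otimes> b)
        = x [^] (m - n) \<otimes> (x [^] n \<otimes> (a \<otimes> inv b) \<otimes> inv (x [^] n))"
      using x c by (simp add: inv_mult_group m_assoc int_pow_diff)
    finally show "m - n \<in> I i"
      unfolding I_def using ab x A.inv_op_closed2[of "x [^] n" "a \<otimes> inv b"] by auto
  qed
  then obtain i1 where i1: "\<And>j. j \<ge> i1 \<Longrightarrow> I j = I i1" by blast
  have "\<exists>i. \<forall>j\<ge>i. H j \<inter> A = H i \<inter> A"
    using acc Hs Hmono A.subgroup_axioms unfolding acc_subgroups_def
    by (elim allE[of _ "\<lambda>i. H i \<inter> A"]) (auto simp: subgroups_Inter_pair)
  then obtain i2 where i2: "\<And>j. j \<ge> i2 \<Longrightarrow> H j \<inter> A = H i2 \<inter> A" by blast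
  define i where "i = max i1 i2"
  have le: "H i \<subseteq> H j" if "i \<le> j" for i j
    using that by (rule lift_Suc_mono_le[of H, OF Hmono])
  have "H j \<subseteq> H i" if "j \<ge> i" for j
  proof
    fix h assume h: "h \<in> H j"
    then obtain m a where ma: "h = x [^] (m::int) \<otimes> a" "a \<in> A"
      using subsetD[OF B subsetD[OF HB h]] by blast
    then have "m \<in> I j" using h unfolding I_def by auto
    then have "m \<in> I i" using i1[of i] i1[of j] that unfolding i_def by simp
    then obtain b where b: "b \<in> A" "x [^] m \<otimes> b \<in> H i" unfolding I_def by auto
    have c: "a \<in> carrier G" "b \<in> carrier G" using ma b by auto
    have "inv (x [^] m \<otimes> b) \<otimes> h \<in> H j"
      using le[OF that] b h Hs by (meson subgroup.m_closed subgroup.m_inv_closed subsetD)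
    moreover have eq: "inv (x [^] m \<otimes> b) \<otimes> h = inv b \<otimes> a"
      using x c ma by (simp add: inv_mult_group m_assoc)
    ultimately have "inv b \<otimes> a \<in> H j \<inter> A" using ma b by auto
    then have "inv b \<otimes> a \<in> H i" using i2[of i] i2[of j] that unfolding i_def by auto
    then have "(x [^] m \<otimes> b) \<otimes> (inv b \<otimes> a) \<in> H i" using b Hs by (meson subgroup.m_closed)
    then show "h \<in> H i" using x c ma by (simp add: m_assoc)
  qed
  then show "\<exists>i. \<forall>j\<ge>i. H j = H i" using le by blast
qed

text \<open>Each lower central quotient is generated by the commutators of the generators of the group
  with the generators of the preceding quotient.\<close>

lemma lcs_quotient_finitely_generated:
  assumes Y: "finite Y" "Y \<subseteq> carrier G" "generate G Y = carrier G"
  shows "\<exists>S. finite S \<and> S \<subseteq> lcs G (Suc k) \<and>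
     (\<forall>D. subgroup D G \<longrightarrow> S \<subseteq> D \<longrightarrow> lcs G (Suc (Suc k)) \<subseteq> D \<longrightarrow> lcs G (Suc k) \<subseteq> D)"
proof (induction k)
  case 0
  have "carrier G \<subseteq> D" if "subgroup D G" "Y \<subseteq> D" for D
    using generate_subgroup_incl[OF that(2,1)] Y by simp
  then show ?case using Y by (intro exI[of _ Y]) simp
next
  case (Suc k)
  then obtain S where S: "finite S" "S \<subseteq> lcs G (Suc k)"
    and SD: "\<And>D. \<lbrakk>subgroup D G; S \<subseteq> D; lcs G (Suc (Suc k)) \<subseteq> D\<rbrakk> \<Longrightarrow> lcs G (Suc k) \<subseteq> D"
    by blast
  define S' where "S' = (\<lambda>(x, s). comm G x s) ` (Y \<times> S)"
  have "finite S'" using Y S by (simp add: S'_def)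
  moreover have S'sub: "S' \<subseteq> lcs G (Suc (Suc k))"
    unfolding S'_def using Y S by (auto simp del: lcs.simps intro!: comm_in_lcs_Suc)
  moreover have "lcs G (Suc (Suc k)) \<subseteq> D"
    if D: "subgroup D G" "S' \<subseteq> D" "lcs G (Suc (Suc (Suc k))) \<subseteq> D" for D
  proof -
    \<comment> \<open>Since \<open>D\<close> contains the next term, commutators with elements of
      \<open>E\<close> lie in \<open>D\<close> again. Hence \<open>E\<close> is normal in
      \<open>G\<close>, and the elements whose commutators with given ones fall into
      \<open>E\<close> form a subgroup. So generators suffice in both variables.\<close>
    define E where "E = D \<inter> lcs G (Suc (Suc k))"
    have E: "subgroup E G" unfolding E_def by (rule subgroups_Inter_pair[OF D(1) lcs_subgroup])
    then interpret E: subgroup E G .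
    have conj: "g \<otimes> d \<otimes> inv g \<in> E" if d: "d \<in> E" and g: "g \<in> carrier G" for d g
    proof -
      have dl: "d \<in> lcs G (Suc (Suc k))" "d \<in> carrier G" using d by (auto simp: E_def simp del: lcs.simps)
      have "comm G g d \<in> D"
        using D(3) comm_in_lcs_Suc[OF g dl(1)] by blast
      then have "comm G g d \<otimes> d \<in> D" using d D(1) by (auto simp: E_def intro: subgroup.m_closed)
      also have "comm G g d \<otimes> d = g \<otimes> d \<otimes> inv g" using g dl by (simp add: comm_def m_assoc)
      finally show ?thesis
        using normal.inv_op_closed2[OF lcs_normal g dl(1)] by (simp add: E_def del: lcs.simps)
    qed
    have conj': "inv g \<otimes> d \<otimes> g \<in> E" if "d \<in> E" "g \<in> carrier G" for d g
      using conj[of d "inv g"] that by simp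
    have "subgroup {y \<in> carrier G. comm G x y \<in> E} G" if x: "x \<in> Y" for x
    proof (rule subgroupI)
      show "{y \<in> carrier G. comm G x y \<in> E} \<noteq> {}"
        using x Y by (auto intro!: exI[of _ \<one>] simp: comm_def)
    qed (use x Y conj conj' in \<open>auto simp: comm_mult_right comm_inv_right subsetD\<close>)
    moreover have "S \<subseteq> {y \<in> carrier G. comm G x y \<in> E}" if x: "x \<in> Y" for x
      using x S'sub D S lcs_carrier by (auto simp: S'_def E_def simp del: lcs.simps)
    moreover have "lcs G (Suc (Suc k)) \<subseteq> {y \<in> carrier G. comm G x y \<in> E}" if x: "x \<in> Y" for x
    proof
      fix y assume y: "y \<in> lcs G (Suc (Suc k))"
      have xc: "x \<in> carrier G" using x Y by auto
      have "comm G x y \<in> D" using comm_in_lcs_Suc[OF xc y] D(3) by blast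
      moreover have "comm G x y \<in> lcs G (Suc (Suc k))"
      proof -
        have "x \<otimes> y \<otimes> inv x \<otimes> inv y \<in> lcs G (Suc (Suc k))"
          using normal.inv_op_closed2[OF lcs_normal xc y] y
          by (meson lcs_subgroup subgroup.m_closed subgroup.m_inv_closed)
        then show ?thesis by (simp add: comm_def del: lcs.simps)
      qed
      ultimately show "y \<in> {y \<in> carrier G. comm G x y \<in> E}"
        using y lcs_carrier by (auto simp: E_def simp del: lcs.simps)
    qed
    ultimately have gens: "comm G x y \<in> E" if "x \<in> Y" "y \<in> lcs G (Suc k)" for x y
      using SD that by blast
    have "subgroup {x \<in> carrier G. \<forall>y\<in>lcs G (Suc k). comm G x y \<in> E} G"
    proof (rule subgroupI)
      show "{x \<in> carrier G. \<forall>y\<in>lcs G (Suc k). comm G x y \<in> E} \<noteq> {}"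
        using lcs_carrier by (auto intro!: exI[of _ \<one>] simp: comm_def simp del: lcs.simps)
    qed (use conj conj' lcs_carrier in \<open>auto simp: comm_mult_left comm_inv_left simp del: lcs.simps\<close>)
    moreover have "Y \<subseteq> {x \<in> carrier G. \<forall>y\<in>lcs G (Suc k). comm G x y \<in> E}"
      using gens Y(2) by (auto simp del: lcs.simps)
    ultimately have "generate G Y \<subseteq> {x \<in> carrier G. \<forall>y\<in>lcs G (Suc k). comm G x y \<in> E}"
      by (intro generate_subgroup_incl)
    then have "(\<Union>x\<in>carrier G. \<Union>y\<in>lcs G (Suc k). {comm G x y}) \<subseteq> E"
      using Y by auto
    then have "lcs G (Suc (Suc k)) \<subseteq> E"
      using generate_subgroup_incl[OF _ E] by simp
    then show ?thesis by (auto simp: E_def)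
  qed
  ultimately show ?case by blast
qed

lemma normal_cyclic_extension:
  assumes D: "D \<lhd> G" and s: "s \<in> carrier G"
    and cD: "\<And>g m::int. g \<in> carrier G \<Longrightarrow> comm G g (s [^] m) \<in> D"
  shows "{s [^] (m::int) \<otimes> d | m d. d \<in> D} \<lhd> G"
proof -
  interpret D: normal D G by fact
  have conj: "inv g \<otimes> d \<otimes> g \<in> D" "g \<otimes> d \<otimes> inv g \<in> D" if "d \<in> D" "g \<in> carrier G" for d g
    using that D.inv_op_closed1 D.inv_op_closed2 by auto
  let ?E = "{s [^] (m::int) \<otimes> d | m d. d \<in> D}"
  have E: "s [^] (m::int) \<otimes> d \<in> ?E" if "d \<in> D" for m d
    using that by blast
  show ?thesis
  proof (rule normal_invI)
    show "subgroup ?E G"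
    proof (rule subgroupI)
      show "?E \<subseteq> carrier G" using s by auto
      show "?E \<noteq> {}" using D.one_closed by blast
      fix a assume "a \<in> ?E"
      then obtain m d where a: "a = s [^] (m::int) \<otimes> d" "d \<in> D" by auto
      have "inv a = s [^] (- m) \<otimes> (s [^] m \<otimes> inv d \<otimes> inv (s [^] m))"
        using a s by (simp add: inv_mult_group m_assoc int_pow_neg)
      moreover have "s [^] m \<otimes> inv d \<otimes> inv (s [^] m) \<in> D"
        using a s by (intro conj) auto
      ultimately show "inv a \<in> ?E" using E by presburger
      fix b assume "b \<in> ?E"
      then obtain n e where b: "b = s [^] (n::int) \<otimes> e" "e \<in> D" by auto
      have "a \<otimes> b = s [^] (m + n) \<otimes> ((inv (s [^] n) \<otimes> d \<otimes> s [^] n) \<otimes> e)"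
        using a b s by (simp add: m_assoc int_pow_mult)
      moreover have "(inv (s [^] n) \<otimes> d \<otimes> s [^] n) \<otimes> e \<in> D"
        using a b s conj by auto
      ultimately show "a \<otimes> b \<in> ?E" using E by presburger
    qed
    fix g a assume g: "g \<in> carrier G" and "a \<in> ?E"
    then obtain m d where a: "a = s [^] (m::int) \<otimes> d" "d \<in> D" by auto
    let ?t = "s [^] m"
    have t: "?t \<in> carrier G" using s by simp
    have "g \<otimes> a \<otimes> inv g = ?t \<otimes> ((inv ?t \<otimes> comm G g ?t \<otimes> ?t) \<otimes> (g \<otimes> d \<otimes> inv g))"
      using a g t by (simp add: comm_def m_assoc)
    moreover have "(inv ?t \<otimes> comm G g ?t \<otimes> ?t) \<otimes> (g \<otimes> d \<otimes> inv g) \<in> D"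
      using D.m_closed[OF conj(1)[OF cD[OF g] t] conj(2)[OF a(2) g]] by simp
    ultimately show "g \<otimes> a \<otimes> inv g \<in> ?E" using E by presburger
  qed
qed

lemma eq_of_mult_inv_eq_one:
  "\<lbrakk>a \<in> carrier G; b \<in> carrier G; a \<otimes> inv b = \<one>\<rbrakk> \<Longrightarrow> a = b"
  using inv_equality[of a "inv b"] by simp

text \<open>The quotient of consecutive terms is finitely generated and central, so finitely many
  cyclic extensions lead from the smaller term up to the larger; each of them preserves normality
  and the chain condition.\<close>

lemma acc_subgroups_lcs_step:
  assumes Y: "finite Y" "Y \<subseteq> carrier G" "generate G Y = carrier G"
    and acc: "acc_subgroups G (lcs G (Suc (Suc k)))"
  shows "acc_subgroups G (lcs G (Suc k))"
proof -
  obtain S where S: "finite S" "S \<subseteq> lcs G (Suc k)"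
    and SD: "\<And>D. \<lbrakk>subgroup D G; S \<subseteq> D; lcs G (Suc (Suc k)) \<subseteq> D\<rbrakk> \<Longrightarrow> lcs G (Suc k) \<subseteq> D"
    using lcs_quotient_finitely_generated[OF Y, of k] by blast
  have "\<exists>D. D \<lhd> G \<and> T \<subseteq> D \<and> lcs G (Suc (Suc k)) \<subseteq> D \<and> acc_subgroups G D"
    if "finite T" "T \<subseteq> lcs G (Suc k)" for T
    using that
  proof (induction T rule: finite_induct)
    case empty
    then show ?case using acc lcs_normal by blast
  next
    case (insert s T)
    then obtain D where D: "D \<lhd> G" "T \<subseteq> D" "lcs G (Suc (Suc k)) \<subseteq> D" "acc_subgroups G D"
      by auto
    interpret D: normal D G by fact
    define E where "E = {s [^] (m::int) \<otimes> d | m d. d \<in> D}"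
    have sl: "s \<in> lcs G (Suc k)" using insert by simp
    then have s: "s \<in> carrier G" by (rule lcs_carrier)
    have "comm G g (s [^] m) \<in> D" if "g \<in> carrier G" for g and m :: int
      using D(3) comm_in_lcs_Suc[OF that subgroup_int_pow_closed[OF lcs_subgroup sl]] by blast
    then have "E \<lhd> G" unfolding E_def by (rule normal_cyclic_extension[OF D(1) s])
    moreover have "acc_subgroups G E"
      by (rule acc_subgroups_cyclic_extension[OF D(1,4) s]) (simp add: E_def)
    moreover have "D \<subseteq> E"
    proof
      fix d assume "d \<in> D"
      then show "d \<in> E" unfolding E_def
        by (auto intro!: exI[of _ "0::int"] exI[of _ d])
    qed
    moreover have "s \<in> E"
      unfolding E_def using s D.one_closed by (auto intro!: exI[of _ "1::int"] exI[of _ \<one>])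
    ultimately show ?case using D by blast
  qed
  then obtain D where D: "D \<lhd> G" "S \<subseteq> D" "lcs G (Suc (Suc k)) \<subseteq> D" "acc_subgroups G D"
    using S by blast
  show ?thesis
    by (rule acc_subgroups_mono[OF D(4) SD[OF normal_imp_subgroup[OF D(1)] D(2,3)]])
qed

lemma acc_subgroups_trivial: "acc_subgroups G {\<one>}"
  unfolding acc_subgroups_def
proof (intro allI impI)
  fix H :: "nat \<Rightarrow> 'a set"
  assume H: "\<forall>i. subgroup (H i) G \<and> H i \<subseteq> {\<one>} \<and> H i \<subseteq> H (Suc i)"
  have "H i = {\<one>}" for i
    using H[rule_format, of i] subgroup.one_closed[of "H i" G] by auto
  then show "\<exists>i. \<forall>j\<ge>i. H j = H i" by simp
qed

lemma acc_subgroups_nilpotent: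
  assumes Y: "finite Y" "Y \<subseteq> carrier G" "generate G Y = carrier G"
    and nil: "lcs G k = {\<one>}"
  shows "acc_subgroups G (carrier G)"
proof (cases k)
  \<comment> \<open>Here \<open>lcs G 0\<close> is the dummy value \<open>carrier G\<close>, so the
    hypothesis says that the group is trivial.\<close>
  case 0
  then show ?thesis using nil acc_subgroups_trivial by simp
next
  case (Suc m)
  have "acc_subgroups G (lcs G (Suc j))" if "j \<le> m" for j
    using that
  proof (induction j rule: inc_induct)
    case base
    then show ?case using nil Suc acc_subgroups_trivial by simp
  qed (rule acc_subgroups_lcs_step[OF Y])
  from this[of 0] show ?thesis by simp
qed

text \<open>The kernels of the iterates of \<open>e\<close> ascend, so those of
  \<open>e ^^ i\<close> and \<open>e ^^ Suc i\<close> coincide for some \<open>i\<close>. Write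
  \<open>x = (e ^^ i) y\<close> by surjectivity: then \<open>y\<close> lies in the second kernel,
  hence in the first, and \<open>x\<close> is trivial.\<close>

lemma hopfian_of_acc:
  assumes acc: "acc_subgroups G (carrier G)"
    and e: "e \<in> hom G G" "e ` carrier G = carrier G"
    and x: "x \<in> carrier G" "e x = \<one>"
  shows "x = \<one>"
proof -
  define H where "H i = {y \<in> carrier G. (e ^^ i) y = \<one>}" for i
  have hom: "(e ^^ i) \<in> hom G G" for i
    by (induction i) (use e in \<open>auto simp: hom_def Pi_iff\<close>)
  have surj: "(e ^^ i) ` carrier G = carrier G" for i
  proof (induction i)
    case (Suc i)
    have "(e ^^ Suc i) ` carrier G = e ` ((e ^^ i) ` carrier G)" by (simp add: image_comp)
    then show ?case using Suc e by simp
  qed simp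
  have e1: "e \<one> = \<one>" using e hom_one is_group by blast
  have "subgroup (H i) G" for i
  proof -
    interpret group_hom G G "e ^^ i"
      using hom is_group by (simp add: group_hom_def group_hom_axioms_def)
    show ?thesis using subgroup_kernel by (simp add: H_def kernel_def)
  qed
  moreover have "H i \<subseteq> H (Suc i)" for i using e1 by (auto simp: H_def)
  moreover have "H i \<subseteq> carrier G" for i by (auto simp: H_def)
  ultimately have "\<exists>i. \<forall>j\<ge>i. H j = H i"
    using acc unfolding acc_subgroups_def by simp
  then obtain i where i: "\<And>j. j \<ge> i \<Longrightarrow> H j = H i" by blast
  obtain y where y: "y \<in> carrier G" "(e ^^ i) y = x" using surj x by (metis imageE)
  then have "y \<in> H (Suc i)" using x by (simp add: H_def)
  then have "y \<in> H i" using i[of "Suc i"] by simp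
  then show ?thesis using y by (simp add: H_def)
qed

end

section \<open>Comparing lower central quotients of two images of one group\<close>

lemma (in normal) rcos_eq_self_iff:
  "x \<in> carrier G \<Longrightarrow> (H #> x = H) = (x \<in> H)"
  by (metis coset_join1 coset_join2 subgroup_axioms)

lemma lcs_nilpotent_quotient:
  assumes "group G"
  shows "lcs (G Mod lcs G k) k = {\<one>\<^bsub>G Mod lcs G k\<^esub>}"
proof -
  interpret group G by fact
  interpret N: normal "lcs G k" G by (rule lcs_normal)
  have "(\<lambda>x. lcs G k #>\<^bsub>G\<^esub> x) ` lcs G k = lcs (G Mod lcs G k) k"
    by (rule lcs_hom_image[OF assms N.factorgroup_is_group N.r_coset_hom_Mod])
      (simp add: carrier_FactGroup)
  moreover have "(\<lambda>x. lcs G k #>\<^bsub>G\<^esub> x) ` lcs G k = {lcs G k}"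
  proof -
    have "lcs G k #>\<^bsub>G\<^esub> x = lcs G k" if "x \<in> lcs G k" for x
      using coset_join2[OF lcs_carrier[OF that] lcs_subgroup that] .
    then have "(\<lambda>x. lcs G k #>\<^bsub>G\<^esub> x) ` lcs G k = (\<lambda>x. lcs G k) ` lcs G k" by simp
    then show ?thesis using N.one_closed by (metis image_constant)
  qed
  ultimately show ?thesis by simp
qed

text \<open>The comparison of kernels makes \<open>q\<close> factor as \<open>q = e \<circ> p\<close> for a surjective, hence injective,
  endomorphism \<open>e\<close> of \<open>Q\<close>.\<close>

lemma kernel_eq_of_hopfian:
  assumes F: "group F" and Q: "group Q"
    and acc: "acc_subgroups Q (carrier Q)"
    and p: "p \<in> hom F Q" "p ` carrier F = carrier Q"
    and q: "q \<in> hom F Q" "q ` carrier F = carrier Q"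
    and le: "\<And>x. x \<in> carrier F \<Longrightarrow> p x = \<one>\<^bsub>Q\<^esub> \<Longrightarrow> q x = \<one>\<^bsub>Q\<^esub>"
    and x: "x \<in> carrier F" "q x = \<one>\<^bsub>Q\<^esub>"
  shows "p x = \<one>\<^bsub>Q\<^esub>"
proof -
  interpret F: group F by fact
  interpret Q: group Q by fact
  interpret p: group_hom F Q p using F Q p by (simp add: group_hom_def group_hom_axioms_def)
  interpret q: group_hom F Q q using F Q q by (simp add: group_hom_def group_hom_axioms_def)
  \<comment> \<open>A preimage under \<open>p\<close> is chosen arbitrarily; \<open>le\<close> makes
    the value independent of the choice.\<close>
  define e where "e y = q (SOME x. x \<in> carrier F \<and> p x = y)" for y
  have e: "e (p x) = q x" if x: "x \<in> carrier F" for x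
  proof -
    obtain z where z: "z \<in> carrier F" "p z = p x" "e (p x) = q z"
      using someI[of "\<lambda>z. z \<in> carrier F \<and> p z = p x" x] x unfolding e_def by blast
    have "p (z \<otimes>\<^bsub>F\<^esub> inv\<^bsub>F\<^esub> x) = \<one>\<^bsub>Q\<^esub>" using x z by simp
    then have "q (z \<otimes>\<^bsub>F\<^esub> inv\<^bsub>F\<^esub> x) = \<one>\<^bsub>Q\<^esub>" using le x z by simp
    then have "q z \<otimes>\<^bsub>Q\<^esub> inv\<^bsub>Q\<^esub> q x = \<one>\<^bsub>Q\<^esub>" using x z by simp
    then have "q z = q x" by (rule Q.eq_of_mult_inv_eq_one[rotated 2]) (use x z in simp_all)
    then show ?thesis using z by simp
  qed
  have "e \<in> hom Q Q"
    unfolding hom_def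
  proof (intro CollectI conjI ballI Pi_I)
    fix a assume "a \<in> carrier Q"
    then obtain x where x: "x \<in> carrier F" "a = p x" using p by auto
    then show "e a \<in> carrier Q" using e by simp
    fix b assume "b \<in> carrier Q"
    then obtain y where y: "y \<in> carrier F" "b = p y" using p by auto
    have "e (p x \<otimes>\<^bsub>Q\<^esub> p y) = e (p (x \<otimes>\<^bsub>F\<^esub> y))" using x y by simp
    also have "\<dots> = e (p x) \<otimes>\<^bsub>Q\<^esub> e (p y)" using x y by (simp add: e del: p.hom_mult)
    finally show "e (a \<otimes>\<^bsub>Q\<^esub> b) = e a \<otimes>\<^bsub>Q\<^esub> e b" using x y by simp
  qed
  moreover have "e ` carrier Q = carrier Q"
  proof -
    have "e ` p ` carrier F = q ` carrier F" by (simp add: image_image e)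
    then show ?thesis using p(2) q(2) by simp
  qed
  ultimately show ?thesis
    using Q.hopfian_of_acc[OF acc, of e "p x"] e x by simp
qed

text \<open>The hypothesis on kernels means that \<open>q\<close> factors through \<open>p\<close>.
  Instead of building the factor map, lift \<open>p x\<close> to an element \<open>c\<close> of
  \<open>lcs F k\<close>: then \<open>x\<close> and \<open>c\<close> differ by an element of the
  kernel of \<open>p\<close>, so \<open>q x = q c\<close>.\<close>

lemma lcs_of_comparable_kernels:
  assumes F: "group F" and G: "group G" and H: "group H"
    and p: "p \<in> hom F G" "p ` carrier F = carrier G"
    and q: "q \<in> hom F H"
    and le: "\<And>x. x \<in> carrier F \<Longrightarrow> p x = \<one>\<^bsub>G\<^esub> \<Longrightarrow> q x = \<one>\<^bsub>H\<^esub>"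
    and qs: "q ` carrier F = carrier H"
    and x: "x \<in> carrier F" "p x \<in> lcs G k"
  shows "q x \<in> lcs H k"
proof -
  interpret p: group_hom F G p using F G p by (simp add: group_hom_def group_hom_axioms_def)
  interpret q: group_hom F H q using F H q by (simp add: group_hom_def group_hom_axioms_def)
  obtain c where c: "c \<in> lcs F k" "p x = p c"
    using x(2) lcs_hom_image[OF F G p, of k] by auto
  have cc: "c \<in> carrier F" using c p.G.lcs_carrier by blast
  have "q (x \<otimes>\<^bsub>F\<^esub> inv\<^bsub>F\<^esub> c) = \<one>\<^bsub>H\<^esub>" using le[of "x \<otimes>\<^bsub>F\<^esub> inv\<^bsub>F\<^esub> c"] x c cc by simp
  then have "q x \<otimes>\<^bsub>H\<^esub> inv\<^bsub>H\<^esub> q c = \<one>\<^bsub>H\<^esub>" using x cc by simp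
  then have "q x = q c"
    by (rule q.H.eq_of_mult_inv_eq_one[rotated 2]) (use x cc in simp_all)
  then show ?thesis using c lcs_hom_image[OF F H q qs, of k] by auto
qed

text \<open>The isomorphism \<open>iso\<close> is abstract and need not be compatible with
  \<open>p\<close> and \<open>q\<close>, so kernels are compared instead. Both maps induce
  epimorphisms \<open>p'\<close> and \<open>q'\<close> from \<open>F\<close> onto the same nilpotent
  quotient of \<open>H\<close>; the kernel of \<open>p'\<close> is contained in that of
  \<open>q'\<close>, and the Hopfian property makes the kernels equal.\<close>

lemma lcs_of_isomorphic_lcs_quotients:
  assumes F: "group F" and G: "group G" and H: "group H"
    and Y: "finite Y" "Y \<subseteq> carrier F" "generate F Y = carrier F"
    and p: "p \<in> hom F G" "p ` carrier F = carrier G"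
    and q: "q \<in> hom F H" "q ` carrier F = carrier H"
    and le: "\<And>x. x \<in> carrier F \<Longrightarrow> p x = \<one>\<^bsub>G\<^esub> \<Longrightarrow> q x = \<one>\<^bsub>H\<^esub>"
    and iso: "G Mod lcs G k \<cong> H Mod lcs H k"
    and x: "x \<in> carrier F" "q x \<in> lcs H k"
  shows "p x \<in> lcs G k"
proof -
  interpret p: group_hom F G p using F G p by (simp add: group_hom_def group_hom_axioms_def)
  interpret q: group_hom F H q using F H q by (simp add: group_hom_def group_hom_axioms_def)
  interpret Gk: normal "lcs G k" G by (rule p.H.lcs_normal)
  interpret Hk: normal "lcs H k" H by (rule q.H.lcs_normal)
  let ?P = "G Mod lcs G k" and ?Q = "H Mod lcs H k"
  obtain i where i: "i \<in> hom ?P ?Q" "bij_betw i (carrier ?P) (carrier ?Q)"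
    using iso by (auto simp: is_iso_def iso_def)
  have P: "group ?P" and Q: "group ?Q"
    by (rule Gk.factorgroup_is_group Hk.factorgroup_is_group)+
  interpret i: group_hom ?P ?Q i using P Q i by (simp add: group_hom_def group_hom_axioms_def)
  define p' where "p' x = i (lcs G k #>\<^bsub>G\<^esub> p x)" for x
  define q' where "q' x = lcs H k #>\<^bsub>H\<^esub> q x" for x
  have p'hom: "p' \<in> hom F ?Q"
    using hom_compose[OF hom_compose[OF p(1) Gk.r_coset_hom_Mod] i(1)]
    by (simp add: p'_def[abs_def] comp_def)
  have q'hom: "q' \<in> hom F ?Q"
    using hom_compose[OF q(1) Hk.r_coset_hom_Mod] by (simp add: q'_def[abs_def] comp_def)
  have p's: "p' ` carrier F = carrier ?Q"
  proof -
    have "p' ` carrier F = i ` (\<lambda>y. lcs G k #>\<^bsub>G\<^esub> y) ` p ` carrier F"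
      by (simp add: p'_def image_image)
    then show ?thesis using i(2) p(2) by (simp add: bij_betw_def carrier_FactGroup)
  qed
  have q's: "q' ` carrier F = carrier ?Q"
  proof -
    have "q' ` carrier F = (\<lambda>y. lcs H k #>\<^bsub>H\<^esub> y) ` q ` carrier F"
      by (simp add: q'_def image_image)
    then show ?thesis using q(2) by (simp add: carrier_FactGroup)
  qed
  have q'1: "q' x = \<one>\<^bsub>?Q\<^esub> \<longleftrightarrow> q x \<in> lcs H k" if "x \<in> carrier F" for x
    using that Hk.rcos_eq_self_iff by (simp add: q'_def)
  have p'1: "p' x = \<one>\<^bsub>?Q\<^esub> \<longleftrightarrow> p x \<in> lcs G k" if x: "x \<in> carrier F" for x
  proof -
    have c: "lcs G k #>\<^bsub>G\<^esub> p x \<in> carrier ?P" using x by (simp add: carrier_FactGroup)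
    have "p' x = \<one>\<^bsub>?Q\<^esub> \<longleftrightarrow> lcs G k #>\<^bsub>G\<^esub> p x = \<one>\<^bsub>?P\<^esub>"
      using i(2) c i.hom_one i.G.one_closed unfolding p'_def bij_betw_def by (metis inj_onD)
    then show ?thesis using x Gk.rcos_eq_self_iff by simp
  qed
  have "acc_subgroups ?Q (carrier ?Q)"
  proof (rule group.acc_subgroups_nilpotent[OF Q])
    show "finite (q' ` Y)" "q' ` Y \<subseteq> carrier ?Q" using Y q's by auto
    interpret q': group_hom F ?Q q' using F Q q'hom by (simp add: group_hom_def group_hom_axioms_def)
    show "generate ?Q (q' ` Y) = carrier ?Q" using q'.generate_img[OF Y(2)] Y q's by simp
    show "lcs ?Q k = {\<one>\<^bsub>?Q\<^esub>}" by (rule lcs_nilpotent_quotient[OF H])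
  qed
  from kernel_eq_of_hopfian[OF F Q this p'hom p's q'hom q's _ x(1)]
  show ?thesis
    using p'1 q'1 x lcs_of_comparable_kernels[OF F G H p q(1) le q(2)] by simp
qed

section \<open>Free groups\<close>

text \<open>Left multiplication of a reduced word by a letter, isolated from \<open>freduce\<close>
  so that reduction becomes a right fold. Letting words act on reduced words in this way is van der
  Waerden's route to associativity; it replaces a confluence argument for cancellations.\<close>

fun fstep :: "nat \<times> bool \<Rightarrow> fword \<Rightarrow> fword" where
  "fstep x [] = [x]"
| "fstep x (y # ys) = (if fst x = fst y \<and> snd x \<noteq> snd y then ys else x # y # ys)"

lemma freduce_Cons: "freduce (x # xs) = fstep x (freduce xs)"
  by (cases "freduce xs") auto

declare freduce.simps(2) [simp del]
declare freduce_Cons [simp]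

lemma freduce_append: "freduce (u @ v) = foldr fstep u (freduce v)"
  by (induction u) auto

lemma freduced_ConsD: "freduced (x # xs) \<Longrightarrow> freduced xs"
  by (cases xs) auto

lemma freduced_fstep: "freduced w \<Longrightarrow> freduced (fstep x w)"
  by (cases w) (auto dest: freduced_ConsD)

lemma freduced_foldr_fstep: "freduced w \<Longrightarrow> freduced (foldr fstep u w)"
  by (induction u) (auto intro: freduced_fstep)

lemma freduced_freduce [simp]: "freduced (freduce w)"
  by (induction w) (auto intro: freduced_fstep)

lemma fstep_eq_Cons: "freduced (x # w) \<Longrightarrow> fstep x w = x # w"
  by (cases w) auto

lemma freduce_id: "freduced w \<Longrightarrow> freduce w = w"
proof (induction w)
  case (Cons x w)
  then show ?case using fstep_eq_Cons freduced_ConsD by fastforce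
qed simp

text \<open>If the inner step cancels a letter, that letter is \<open>x\<close>, and reducedness
  ensures that the outer step puts it back without cancelling again.\<close>

lemma fstep_cancel:
  assumes "freduced w" "fst x = fst y" "snd x \<noteq> snd y"
  shows "fstep x (fstep y w) = w"
proof (cases w)
  case (Cons z zs)
  show ?thesis
  proof (cases "fst y = fst z \<and> snd y \<noteq> snd z")
    case True
    then have "x = z" using assms by (auto simp: prod_eq_iff)
    then show ?thesis using True Cons assms fstep_eq_Cons by auto
  qed (use Cons assms in auto)
qed (use assms in auto)

lemma foldr_fstep_fstep:
  assumes "freduced w"
  shows "foldr fstep (fstep x v) w = fstep x (foldr fstep v w)"
proof (cases v)
  case (Cons y ys)
  then show ?thesis
    using fstep_cancel[OF freduced_foldr_fstep[OF assms], of x y ys] by auto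
qed simp

lemma foldr_fstep_freduce: "freduced w \<Longrightarrow> foldr fstep (freduce u) w = foldr fstep u w"
  by (induction u) (auto simp: foldr_fstep_fstep)

lemma freduce_append_left: "freduce (freduce u @ v) = freduce (u @ v)"
  by (simp add: freduce_append foldr_fstep_freduce)

lemma freduce_append_right: "freduce (u @ freduce v) = freduce (u @ v)"
  by (simp add: freduce_append freduce_id)

lemma set_fstep: "set (fstep x w) \<subseteq> insert x (set w)"
  by (cases w) auto

lemma set_freduce: "set (freduce w) \<subseteq> set w"
proof (induction w)
  case (Cons x w)
  then show ?case using set_fstep[of x "freduce w"] by auto
qed simp

definition finv :: "fword \<Rightarrow> fword" where
  "finv w = rev (map (\<lambda>x. (fst x, \<not> snd x)) w)"

lemma freduce_finv_append: "freduce (finv w @ w) = []"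
proof (induction w)
  case (Cons x w)
  have "freduce (finv (x # w) @ x # w)
      = foldr fstep (finv w) (fstep (fst x, \<not> snd x) (fstep x (freduce w)))"
    by (simp add: finv_def freduce_append)
  also have "\<dots> = freduce (finv w @ w)"
    by (simp add: freduce_append fstep_cancel)
  finally show ?case using Cons by simp
qed (simp add: finv_def)

lemma carrier_free_group:
  "carrier (free_group n) = {w. freduced w \<and> (\<forall>x\<in>set w. fst x < n)}"
  by (simp add: free_group_def)

lemma mult_free_group: "u \<otimes>\<^bsub>free_group n\<^esub> v = freduce (u @ v)"
  by (simp add: free_group_def)

lemma one_free_group: "\<one>\<^bsub>free_group n\<^esub> = []"
  by (simp add: free_group_def)

lemma group_free_group: "group (free_group n)"
proof (rule groupI)
  fix u v assume "u \<in> carrier (free_group n)" "v \<in> carrier (free_group n)"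
  then show "u \<otimes>\<^bsub>free_group n\<^esub> v \<in> carrier (free_group n)"
    using set_freduce[of "u @ v"] by (auto simp: carrier_free_group mult_free_group)
next
  fix u v w
  show "u \<otimes>\<^bsub>free_group n\<^esub> v \<otimes>\<^bsub>free_group n\<^esub> w = u \<otimes>\<^bsub>free_group n\<^esub> (v \<otimes>\<^bsub>free_group n\<^esub> w)"
    by (simp add: mult_free_group freduce_append_left freduce_append_right)
next
  fix w assume w: "w \<in> carrier (free_group n)"
  show "\<exists>v\<in>carrier (free_group n). v \<otimes>\<^bsub>free_group n\<^esub> w = \<one>\<^bsub>free_group n\<^esub>"
  proof
    show "freduce (finv w) \<otimes>\<^bsub>free_group n\<^esub> w = \<one>\<^bsub>free_group n\<^esub>"
      by (simp add: mult_free_group one_free_group freduce_append_left freduce_finv_append)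
    show "freduce (finv w) \<in> carrier (free_group n)"
      using w set_freduce[of "finv w"] by (force simp: carrier_free_group finv_def)
  qed
qed (auto simp: carrier_free_group mult_free_group one_free_group freduce_id)

lemma fgen_carrier: "i < n \<Longrightarrow> fgen i \<in> carrier (free_group n)"
  by (simp add: fgen_def carrier_free_group)

lemma inv_fgen:
  assumes "i < n"
  shows "inv\<^bsub>free_group n\<^esub> (fgen i) = [(i, False)]"
proof -
  interpret group "free_group n" by (rule group_free_group)
  show ?thesis
    by (rule inv_equality)
      (use assms in \<open>auto simp: fgen_def carrier_free_group mult_free_group one_free_group\<close>)
qed

lemma free_group_induct [consumes 1, case_names one gen inv]:
  assumes "w \<in> carrier (free_group n)"
    and "P []"
    and gen: "\<And>i w. \<lbrakk>i < n; w \<in> carrier (free_group n); P w\<rbrakk>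
                \<Longrightarrow> P (fgen i \<otimes>\<^bsub>free_group n\<^esub> w)"
    and inv: "\<And>i w. \<lbrakk>i < n; w \<in> carrier (free_group n); P w\<rbrakk>
                \<Longrightarrow> P (inv\<^bsub>free_group n\<^esub> (fgen i) \<otimes>\<^bsub>free_group n\<^esub> w)"
  shows "P w"
  using assms(1)
proof (induction w)
  case (Cons x w)
  obtain i b where x: "x = (i, b)" by (cases x)
  have w: "w \<in> carrier (free_group n)" and i: "i < n"
    using Cons(2) x by (auto simp: carrier_free_group dest: freduced_ConsD)
  have red: "fstep x w = x # w" "freduce w = w"
    using Cons(2) w by (auto simp: carrier_free_group fstep_eq_Cons freduce_id)
  have "[x] \<otimes>\<^bsub>free_group n\<^esub> w = x # w"
    using red by (simp add: mult_free_group)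
  then show ?case
    using gen[OF i w] inv[OF i w] Cons(1)[OF w] x
    by (cases b) (auto simp: fgen_def inv_fgen[OF i, unfolded fgen_def])
qed (use assms in simp)

lemma generate_fgen: "generate (free_group n) (fgen ` {..<n}) = carrier (free_group n)"
proof
  interpret group "free_group n" by (rule group_free_group)
  show "generate (free_group n) (fgen ` {..<n}) \<subseteq> carrier (free_group n)"
    by (rule generate_incl) (auto intro: fgen_carrier)
  show "carrier (free_group n) \<subseteq> generate (free_group n) (fgen ` {..<n})"
  proof
    fix w assume "w \<in> carrier (free_group n)"
    then show "w \<in> generate (free_group n) (fgen ` {..<n})"
    proof (induction rule: free_group_induct)
      case one
      then show ?case using generate.one[of "free_group n"] by (simp add: one_free_group)
    qed (auto intro: generate.eng generate.incl generate.inv)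
  qed
qed

text \<open>The extension of \<open>f\<close> given by the universal property. It is defined on
  unreduced words too, so that multiplicativity on concatenations and invariance under reduction can
  be proved separately.\<close>

definition feval :: "('a, 'b) monoid_scheme \<Rightarrow> (nat \<Rightarrow> 'a) \<Rightarrow> fword \<Rightarrow> 'a" where
  "feval H f w = foldr (\<lambda>x acc. (if snd x then f (fst x) else inv\<^bsub>H\<^esub> f (fst x)) \<otimes>\<^bsub>H\<^esub> acc) w \<one>\<^bsub>H\<^esub>"

lemma feval_Nil [simp]: "feval H f [] = \<one>\<^bsub>H\<^esub>"
  by (simp add: feval_def)

lemma feval_Cons [simp]:
  "feval H f (x # w) = (if snd x then f (fst x) else inv\<^bsub>H\<^esub> f (fst x)) \<otimes>\<^bsub>H\<^esub> feval H f w"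
  by (simp add: feval_def)

context group
begin

lemma feval_closed: "(\<And>x. x \<in> set w \<Longrightarrow> f (fst x) \<in> carrier G) \<Longrightarrow> feval G f w \<in> carrier G"
  by (induction w) auto

lemma feval_append:
  "(\<And>x. x \<in> set (u @ v) \<Longrightarrow> f (fst x) \<in> carrier G)
    \<Longrightarrow> feval G f (u @ v) = feval G f u \<otimes> feval G f v"
  by (induction u) (auto simp: m_assoc feval_closed)

lemma feval_fstep:
  assumes "\<And>y. y \<in> insert x (set w) \<Longrightarrow> f (fst y) \<in> carrier G"
  shows "feval G f (fstep x w) = feval G f (x # w)"
proof (cases w)
  case (Cons y ys)
  have "f (fst x) \<in> carrier G" "feval G f ys \<in> carrier G"
    using assms[of x] assms Cons by (simp, intro feval_closed assms, simp add: Cons)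
  then show ?thesis using Cons by auto
qed simp

lemma feval_freduce:
  "(\<And>x. x \<in> set w \<Longrightarrow> f (fst x) \<in> carrier G) \<Longrightarrow> feval G f (freduce w) = feval G f w"
proof (induction w)
  case (Cons x w)
  have "feval G f (fstep x (freduce w)) = feval G f (x # freduce w)"
    by (rule feval_fstep) (use Cons(2) set_freduce[of w] in auto)
  then show ?case using Cons by simp
qed simp

lemma feval_hom:
  assumes "\<And>i. i < n \<Longrightarrow> f i \<in> carrier G"
  shows "feval G f \<in> hom (free_group n) G"
  unfolding hom_def
proof (intro CollectI conjI ballI Pi_I)
  fix u assume u: "u \<in> carrier (free_group n)"
  then show "feval G f u \<in> carrier G"
    using assms by (auto simp: carrier_free_group intro: feval_closed)
  fix v assume v: "v \<in> carrier (free_group n)"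
  show "feval G f (u \<otimes>\<^bsub>free_group n\<^esub> v) = feval G f u \<otimes> feval G f v"
  proof -
    have "f (fst x) \<in> carrier G" if "x \<in> set (u @ v)" for x
      using that assms u v by (auto simp: carrier_free_group)
    then show ?thesis
      unfolding mult_free_group using feval_freduce[of "u @ v" f] feval_append[of u v f] by metis
  qed
qed

lemma feval_fgen: "f i \<in> carrier G \<Longrightarrow> feval G f (fgen i) = f i"
  by (simp add: fgen_def)

lemma hom_free_group_eqI:
  assumes h: "h \<in> hom (free_group n) G" "h' \<in> hom (free_group n) G"
    and eq: "\<And>i. i < n \<Longrightarrow> h (fgen i) = h' (fgen i)"
    and w: "w \<in> carrier (free_group n)"
  shows "h w = h' w"
proof -
  interpret h: group_hom "free_group n" G h
    using h is_group group_free_group by (simp add: group_hom_def group_hom_axioms_def)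
  interpret h': group_hom "free_group n" G h'
    using h is_group group_free_group by (simp add: group_hom_def group_hom_axioms_def)
  show ?thesis using w
  proof (induction rule: free_group_induct)
    case one
    then show ?case using h.hom_one h'.hom_one by (simp add: one_free_group)
  qed (use eq fgen_carrier in auto)
qed

end

section \<open>Surface words, their images and normal closures\<close>

definition comm_prod :: "('a, 'b) monoid_scheme \<Rightarrow> (nat \<Rightarrow> 'a) \<Rightarrow> nat list \<Rightarrow> 'a" where
  "comm_prod G f js =
     foldr (\<lambda>j acc. comm G (f (2 * j)) (f (2 * j + 1)) \<otimes>\<^bsub>G\<^esub> acc) js \<one>\<^bsub>G\<^esub>"

lemma comm_prod_simps [simp]:
  "comm_prod G f [] = \<one>\<^bsub>G\<^esub>"
  "comm_prod G f (j # js) = comm G (f (2 * j)) (f (2 * j + 1)) \<otimes>\<^bsub>G\<^esub> comm_prod G f js"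
  by (simp_all add: comm_prod_def)

lemma surface_word_eq: "surface_word g = comm_prod (free_group (2 * g)) fgen [0..<g]"
  by (simp add: surface_word_def comm_prod_def)

lemma (in group) comm_prod_closed:
  "(\<And>j. j \<in> set js \<Longrightarrow> f (2 * j) \<in> carrier G \<and> f (2 * j + 1) \<in> carrier G)
    \<Longrightarrow> comm_prod G f js \<in> carrier G"
  by (induction js) auto

lemma (in group_hom) hom_comm_prod:
  "(\<And>j. j \<in> set js \<Longrightarrow> f (2 * j) \<in> carrier G \<and> f (2 * j + 1) \<in> carrier G)
    \<Longrightarrow> h (comm_prod G f js) = comm_prod H (\<lambda>i. h (f i)) js"
proof (induction js)
  case (Cons j js)
  then show ?case
    using G.comm_prod_closed[of js f]
    by (simp add: hom_comm[OF G.is_group H.is_group homh])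
qed simp

lemma surface_word_carrier: "surface_word g \<in> carrier (free_group (2 * g))"
  unfolding surface_word_eq
  by (rule group.comm_prod_closed[OF group_free_group]) (auto intro!: fgen_carrier)

lemma hom_surface_word:
  assumes "group H" "h \<in> hom (free_group (2 * g)) H"
  shows "h (surface_word g) = comm_prod H (\<lambda>i. h (fgen i)) [0..<g]"
proof -
  interpret group_hom "free_group (2 * g)" H h
    using assms group_free_group by (simp add: group_hom_def group_hom_axioms_def)
  show ?thesis unfolding surface_word_eq by (rule hom_comm_prod) (auto intro!: fgen_carrier)
qed

context group
begin

lemma normal_closure_normal:
  assumes "S \<subseteq> carrier G"
  shows "normal_closure G S \<lhd> G"
  unfolding normal_closure_def
proof (rule normal_generateI)
  show "(\<Union>h\<in>carrier G. (\<lambda>s. h \<otimes> s \<otimes> inv h) ` S) \<subseteq> carrier G" using assms by auto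
  fix x g assume "x \<in> (\<Union>h\<in>carrier G. (\<lambda>s. h \<otimes> s \<otimes> inv h) ` S)" and g: "g \<in> carrier G"
  then obtain h s where hs: "h \<in> carrier G" "s \<in> S" "x = h \<otimes> s \<otimes> inv h" by auto
  then have "g \<otimes> x \<otimes> inv g = (g \<otimes> h) \<otimes> s \<otimes> inv (g \<otimes> h)"
    using g assms by (auto simp: inv_mult_group m_assoc subsetD)
  moreover have "g \<otimes> h \<in> carrier G" using g hs by simp
  ultimately show "g \<otimes> x \<otimes> inv g \<in> (\<Union>h\<in>carrier G. (\<lambda>s. h \<otimes> s \<otimes> inv h) ` S)"
    using hs(2) by blast
qed

lemma normal_closure_mem: "s \<in> S \<Longrightarrow> S \<subseteq> carrier G \<Longrightarrow> s \<in> normal_closure G S"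
  unfolding normal_closure_def
  by (rule generate.incl) (auto intro!: bexI[of _ \<one>] image_eqI[of _ _ s])

lemma normal_closure_subset:
  assumes "S \<subseteq> N" "N \<lhd> G"
  shows "normal_closure G S \<subseteq> N"
  unfolding normal_closure_def
  using assms
  by (intro generate_subgroup_incl normal_imp_subgroup) (auto simp: normal.inv_op_closed2 subsetD)

end

lemma normal_closure_kernel:
  assumes "group G" "group H" "h \<in> hom G H" "S \<subseteq> carrier G" "\<And>s. s \<in> S \<Longrightarrow> h s = \<one>\<^bsub>H\<^esub>"
    and "x \<in> normal_closure G S"
  shows "h x = \<one>\<^bsub>H\<^esub>"
proof -
  interpret group_hom G H h
    using assms by (simp add: group_hom_def group_hom_axioms_def)
  have "normal_closure G S \<subseteq> kernel G H h"
    by (rule G.normal_closure_subset[OF _ normal_kernel]) (use assms in \<open>auto simp: kernel_def\<close>)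
  then show ?thesis using assms(6) by (auto simp: kernel_def)
qed

section \<open>The genus two surface group contains the surface groups of higher genus\<close>

lemma (in group) comm_prod_append:
  assumes "\<And>j. j \<in> set (js @ ks) \<Longrightarrow> f (2 * j) \<in> carrier G \<and> f (2 * j + 1) \<in> carrier G"
  shows "comm_prod G f (js @ ks) = comm_prod G f js \<otimes> comm_prod G f ks"
  using assms
proof (induction js)
  case Nil
  then show ?case using comm_prod_closed[of ks f] by simp
next
  case (Cons j js)
  then show ?case
    using comm_prod_closed[of js f] comm_prod_closed[of ks f] by (simp add: m_assoc)
qed

lemma hom_surface_word_2:
  assumes "group H" "h \<in> hom (free_group 4) H"
  shows "h (surface_word 2) =
    comm H (h (fgen 0)) (h (fgen 1)) \<otimes>\<^bsub>H\<^esub> comm H (h (fgen 2)) (h (fgen 3))"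
proof -
  interpret group_hom "free_group 4" H h
    using assms group_free_group by (simp add: group_hom_def group_hom_axioms_def)
  have "h (fgen i) \<in> carrier H" if "i < 4" for i using that fgen_carrier by simp
  moreover have "[0..<2] = [0, 1::nat]" by (simp add: upt_conv_Cons)
  ultimately show ?thesis
    using hom_surface_word[of H h 2] assms by simp
qed

text \<open>Generators of the kernel of the map to the integers modulo \<open>n\<close> sending
  \<open>a\<close> to 1 and \<open>b\<close>, \<open>c\<close>, \<open>d\<close> to 0: the pair
  \<open>a [^] n\<close>, \<open>b\<close>, followed by the pairs of conjugates of \<open>c\<close>
  and \<open>d\<close> by the powers of \<open>a\<close> with exponents below \<open>n\<close>. The
  other conjugates of \<open>b\<close> are expressed through these by the genus two
  relation.\<close>

definition cover_gens :: "('a, 'b) monoid_scheme \<Rightarrow> nat \<Rightarrow> 'a \<Rightarrow> 'a \<Rightarrow> 'a \<Rightarrow> 'a \<Rightarrow> nat \<Rightarrow> 'a" where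
  "cover_gens G n a b c d i =
     (if i = 0 then a [^]\<^bsub>G\<^esub> n else if i = 1 then b
      else a [^]\<^bsub>G\<^esub> (i div 2 - 1) \<otimes>\<^bsub>G\<^esub> (if even i then c else d) \<otimes>\<^bsub>G\<^esub> inv\<^bsub>G\<^esub> (a [^]\<^bsub>G\<^esub> (i div 2 - 1)))"

lemma cover_gens_simps [simp]:
  "cover_gens G n a b c d 0 = a [^]\<^bsub>G\<^esub> n"
  "cover_gens G n a b c d (Suc 0) = b"
  "cover_gens G n a b c d (Suc (Suc (2 * k))) = a [^]\<^bsub>G\<^esub> k \<otimes>\<^bsub>G\<^esub> c \<otimes>\<^bsub>G\<^esub> inv\<^bsub>G\<^esub> (a [^]\<^bsub>G\<^esub> k)"
  "cover_gens G n a b c d (Suc (Suc (Suc (2 * k)))) = a [^]\<^bsub>G\<^esub> k \<otimes>\<^bsub>G\<^esub> d \<otimes>\<^bsub>G\<^esub> inv\<^bsub>G\<^esub> (a [^]\<^bsub>G\<^esub> k)"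
  by (simp_all add: cover_gens_def)

context group
begin

lemma cover_gens_closed:
  "\<lbrakk>a \<in> carrier G; b \<in> carrier G; c \<in> carrier G; d \<in> carrier G\<rbrakk>
    \<Longrightarrow> cover_gens G n a b c d i \<in> carrier G"
  by (simp add: cover_gens_def)

text \<open>The relation gives \<open>[c,d] = [b,a]\<close>, so the product of the conjugates of
  \<open>[c,d]\<close> telescopes to \<open>[b, a^n]\<close>, the inverse of the first factor
  \<open>[a^n, b]\<close>.\<close>

lemma comm_prod_cover_gens:
  assumes c: "a \<in> carrier G" "b \<in> carrier G" "c \<in> carrier G" "d \<in> carrier G"
    and rel: "comm G a b \<otimes> comm G c d = \<one>"
  shows "comm_prod G (cover_gens G n a b c d) [0..<Suc n] = \<one>"
proof -
  let ?f = "cover_gens G n a b c d"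
  have cd: "comm G c d = comm G b a"
    using inv_equality[OF rel] c inv_commutator[of a b]
    by (metis comm_closed inv_commutator inv_equality inv_inv rel)
  have "comm_prod G ?f [1..<Suc m] = b \<otimes> a [^] m \<otimes> inv b \<otimes> inv (a [^] m)" for m
  proof (induction m)
    case 0
    then show ?case using c by simp
  next
    case (Suc m)
    have "comm_prod G ?f [1..<Suc (Suc m)]
        = comm_prod G ?f [1..<Suc m] \<otimes> comm G (?f (2 * Suc m)) (?f (2 * Suc m + 1))"
      using comm_prod_append[of "[1..<Suc m]" "[Suc m]" ?f] c by (simp add: cover_gens_closed)
    also have "comm G (?f (2 * Suc m)) (?f (2 * Suc m + 1)) = a [^] m \<otimes> comm G b a \<otimes> inv (a [^] m)"
      using comm_conj[of "a [^] m" c d] c cd by simp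
    finally show ?case
      unfolding Suc using c by (simp add: comm_def m_assoc inv_mult_group)
  qed
  then have "comm_prod G ?f [0..<Suc n]
      = comm G (a [^] n) b \<otimes> (b \<otimes> a [^] n \<otimes> inv b \<otimes> inv (a [^] n))"
    using upt_conv_Cons[of 0 "Suc n"] by simp
  then show ?thesis using c by (simp add: comm_def m_assoc inv_mult_group)
qed

end

text \<open>A wreath-type extension: the infinite cyclic group acts by shifts on the
  \<open>n\<close>-periodic functions from the integers to \<open>G\<close>.\<close>

definition shift_group :: "('a, 'b) monoid_scheme \<Rightarrow> nat \<Rightarrow> ((int \<Rightarrow> 'a) \<times> int) monoid" where
  "shift_group G n =
     \<lparr> carrier = {x. \<forall>i. fst x i \<in> carrier G \<and> fst x (i + int n) = fst x i},
       monoid.mult = (\<lambda>x y. (\<lambda>i. fst x i \<otimes>\<^bsub>G\<^esub> fst y (i + snd x), snd x + snd y)),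
       one = (\<lambda>i. \<one>\<^bsub>G\<^esub>, 0) \<rparr>"

lemma carrier_shift_group:
  "x \<in> carrier (shift_group G n) \<longleftrightarrow> (\<forall>i. fst x i \<in> carrier G \<and> fst x (i + int n) = fst x i)"
  by (simp add: shift_group_def)

lemma mult_shift_group:
  "x \<otimes>\<^bsub>shift_group G n\<^esub> y = (\<lambda>i. fst x i \<otimes>\<^bsub>G\<^esub> fst y (i + snd x), snd x + snd y)"
  by (simp add: shift_group_def)

lemma one_shift_group: "\<one>\<^bsub>shift_group G n\<^esub> = (\<lambda>i. \<one>\<^bsub>G\<^esub>, 0)"
  by (simp add: shift_group_def)

lemma shift_group_period:
  assumes "x \<in> carrier (shift_group G n)" "int n dvd s"
  shows "fst x (i + s) = fst x i"
proof -
  have up: "fst x (i + int (n * k)) = fst x i" for i k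
  proof (induction k)
    case (Suc k)
    have "fst x (i + int (n * k) + int n) = fst x (i + int (n * k))"
      using assms(1) unfolding carrier_shift_group by blast
    then show ?case using Suc by (simp add: algebra_simps)
  qed simp
  from assms(2) obtain q where q: "s = int n * q" by blast
  show ?thesis
  proof (cases "q \<ge> 0")
    case True
    then show ?thesis using up[of i "nat q"] q by simp
  next
    case False
    then show ?thesis using up[of "i + s" "nat (- q)"] q by simp
  qed
qed

context group
begin

lemma inv_shift_exists:
  assumes x: "x \<in> carrier (shift_group G n)"
  shows "(\<lambda>i. inv (fst x (i - snd x)), - snd x) \<in> carrier (shift_group G n)"
    and "(\<lambda>i. inv (fst x (i - snd x)), - snd x) \<otimes>\<^bsub>shift_group G n\<^esub> x = \<one>\<^bsub>shift_group G n\<^esub>"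
proof -
  have "fst x (i + int n - snd x) = fst x (i - snd x)" for i
    using x unfolding carrier_shift_group by (metis add.commute add_diff_eq)
  then show "(\<lambda>i. inv (fst x (i - snd x)), - snd x) \<in> carrier (shift_group G n)"
    using x by (simp add: carrier_shift_group)
  show "(\<lambda>i. inv (fst x (i - snd x)), - snd x) \<otimes>\<^bsub>shift_group G n\<^esub> x = \<one>\<^bsub>shift_group G n\<^esub>"
    using x by (simp add: carrier_shift_group mult_shift_group one_shift_group)
qed

lemma group_shift_group: "group (shift_group G n)"
proof (rule groupI)
  fix x y assume x: "x \<in> carrier (shift_group G n)" and y: "y \<in> carrier (shift_group G n)"
  have "fst y (i + int n + snd x) = fst y (i + snd x)" for i
    using y unfolding carrier_shift_group by (metis add.assoc add.commute)
  then show "x \<otimes>\<^bsub>shift_group G n\<^esub> y \<in> carrier (shift_group G n)"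
    using x y by (simp add: carrier_shift_group mult_shift_group)
next
  fix x y z
  assume "x \<in> carrier (shift_group G n)" "y \<in> carrier (shift_group G n)" "z \<in> carrier (shift_group G n)"
  then show "x \<otimes>\<^bsub>shift_group G n\<^esub> y \<otimes>\<^bsub>shift_group G n\<^esub> z = x \<otimes>\<^bsub>shift_group G n\<^esub> (y \<otimes>\<^bsub>shift_group G n\<^esub> z)"
    by (simp add: carrier_shift_group mult_shift_group m_assoc add.assoc)
next
  fix x assume x: "x \<in> carrier (shift_group G n)"
  then show "\<exists>y\<in>carrier (shift_group G n). y \<otimes>\<^bsub>shift_group G n\<^esub> x = \<one>\<^bsub>shift_group G n\<^esub>"
    using inv_shift_exists by blast
  show "\<one>\<^bsub>shift_group G n\<^esub> \<otimes>\<^bsub>shift_group G n\<^esub> x = x"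
    using x by (simp add: carrier_shift_group mult_shift_group one_shift_group prod_eq_iff)
qed (simp add: carrier_shift_group one_shift_group)

lemma inv_shift_group:
  "x \<in> carrier (shift_group G n)
    \<Longrightarrow> inv\<^bsub>shift_group G n\<^esub> x = (\<lambda>i. inv (fst x (i - snd x)), - snd x)"
  using group.inv_equality[OF group_shift_group] inv_shift_exists by blast

lemma comm_shift_group_zero:
  assumes "x \<in> carrier (shift_group G n)" "y \<in> carrier (shift_group G n)" "snd x = 0" "snd y = 0"
  shows "comm (shift_group G n) x y = (\<lambda>i. comm G (fst x i) (fst y i), 0)"
  using assms by (simp add: comm_def inv_shift_group mult_shift_group)

end

text \<open>The cyclic cover of degree \<open>n\<close> of the genus two surface embeds the genus \<open>n + 1\<close> surface
  group into the genus two surface group; the action of the latter on the cosets of the former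
  recovers an element from its image.\<close>

lemma cover_gens_detect:
  fixes G (structure) and n :: nat
  defines "F \<equiv> free_group (2 * Suc n)"
    and "cov \<equiv> feval (free_group 4) (cover_gens (free_group 4) n (fgen 0) (fgen 1) (fgen 2) (fgen 3))"
  assumes G: "group G" and n: "n > 0"
    and f: "\<And>i. i < 2 * Suc n \<Longrightarrow> f i \<in> carrier G"
    and rel: "comm_prod G f [0..<Suc n] = \<one>"
    and v: "v \<in> carrier F" "cov v \<in> normal_closure (free_group 4) {surface_word 2}"
  shows "feval G f v = \<one>"
proof -
  interpret group G by fact
  let ?W = "shift_group G n"
  interpret W: group ?W by (rule group_shift_group)
  define P where "P k = comm_prod G f [1..<Suc k]" for k
  \<comment> \<open>The coordinate of \<open>b\<close> at the coset of \<open>a^k\<close>. It is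
    forced by the genus two relation in the form \<open>[c,d] a b = b a\<close>, which in
    coordinates says that \<beta> changes by one commutator per step, starting with
    \<open>f 1\<close>. The hypothesis \<open>rel\<close> closes the cycle by giving
    \<open>\<beta> n = f 0 \<otimes> f 1 \<otimes> inv (f 0)\<close>.\<close>
  define \<beta> where "\<beta> k = inv (P k) \<otimes> f 1" for k
  have Pc: "P k \<in> carrier G" if "k \<le> n" for k
    unfolding P_def by (rule comm_prod_closed) (use that f in auto)
  have fc: "f 0 \<in> carrier G" "f 1 \<in> carrier G" using f by auto
  have fk: "f (2 * Suc k) \<in> carrier G" "f (2 * Suc k + 1) \<in> carrier G" if "k < n" for k
    using f that by auto
  have \<beta>c: "\<beta> k \<in> carrier G" if "k \<le> n" for k using Pc[OF that] fc by (simp add: \<beta>_def)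
  have PSuc: "P (Suc k) = P k \<otimes> comm G (f (2 * Suc k)) (f (2 * Suc k + 1))" if "k < n" for k
  proof -
    have "comm_prod G f ([1..<Suc k] @ [Suc k]) = P k \<otimes> comm_prod G f [Suc k]"
      unfolding P_def by (rule comm_prod_append) (use f that in auto)
    then show ?thesis using fk[OF that] by (simp add: P_def)
  qed
  have \<beta>Suc: "comm G (f (2 * Suc k)) (f (2 * Suc k + 1)) \<otimes> \<beta> (Suc k) = \<beta> k" if "k < n" for k
    using PSuc[OF that] Pc[of k] fk[OF that] fc that
    by (simp add: \<beta>_def inv_mult_group m_assoc)
  have "comm G (f 0) (f 1) \<otimes> P n = \<one>"
    using rel upt_conv_Cons[of 0 "Suc n"] by (simp add: P_def)
  then have "inv (P n) = comm G (f 0) (f 1)"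
    using inv_equality[of "comm G (f 0) (f 1)" "P n"] Pc[of n] fc by simp
  then have \<beta>n: "\<beta> n = f 0 \<otimes> f 1 \<otimes> inv (f 0)"
    using fc by (simp add: \<beta>_def comm_def m_assoc)
  have \<beta>0: "\<beta> 0 = f 1" using fc by (simp add: \<beta>_def P_def)
  define r where "r i = nat (i mod int n)" for i
  have r: "r i < n" "r (i + int n) = r i" for i
    using n by (auto simp: r_def nat_less_iff)
  have r_small: "r (int k) = k" if "k < n" for k
    using that by (simp add: r_def)
  have r_Suc: "r (i + 1) = (if r i = n - 1 then 0 else Suc (r i))" for i
  proof -
    define m where "m = i mod int n"
    have m: "0 \<le> m" "m < int n" using n by (simp_all add: m_def)
    have "(i + 1) mod int n = (m + 1) mod int n" by (simp add: m_def mod_add_left_eq)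
    also have "\<dots> = (if m = int n - 1 then 0 else m + 1)" using m by auto
    finally have "r (i + 1) = nat (if m = int n - 1 then 0 else m + 1)" by (simp add: r_def)
    moreover have "r i = nat m" by (simp add: r_def m_def)
    ultimately show ?thesis using m n by (auto simp: nat_add_distrib)
  qed
  \<comment> \<open>As in an induced representation, coordinates are indexed by cosets.
    \<open>a\<close> moves to the next coset and contributes \<open>f 0\<close>, the value intended
    for \<open>a^n\<close>, only on passing from the last coset to the first.\<close>
  define a :: "(int \<Rightarrow> 'a) \<times> int" where "a = (\<lambda>i. if r i = n - 1 then f 0 else \<one>, 1)"
  define b :: "(int \<Rightarrow> 'a) \<times> int" where "b = (\<lambda>i. \<beta> (r i), 0)"
  define c :: "(int \<Rightarrow> 'a) \<times> int" where "c = (\<lambda>i. f (2 * Suc (r i)), 0)"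
  define d :: "(int \<Rightarrow> 'a) \<times> int" where "d = (\<lambda>i. f (2 * Suc (r i) + 1), 0)"
  have W: "a \<in> carrier ?W" "b \<in> carrier ?W" "c \<in> carrier ?W" "d \<in> carrier ?W"
    using fc r fk[OF r(1)] \<beta>c[OF less_imp_le[OF r(1)]]
    by (auto simp: carrier_shift_group a_def b_def c_def d_def)
  have "comm ?W c d \<otimes>\<^bsub>?W\<^esub> (a \<otimes>\<^bsub>?W\<^esub> b) = b \<otimes>\<^bsub>?W\<^esub> a"
  proof (rule prod_eqI)
    have *: "comm G (f (2 * Suc (r i))) (f (2 * Suc (r i) + 1)) \<otimes>
          ((if r i = n - 1 then f 0 else \<one>) \<otimes> \<beta> (r (i + 1)))
        = \<beta> (r i) \<otimes> (if r i = n - 1 then f 0 else \<one>)" for i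
    proof (cases "r i = n - 1")
      case True
      have "f 0 \<otimes> \<beta> 0 = \<beta> n \<otimes> f 0" using \<beta>n \<beta>0 fc by (simp add: m_assoc)
      then show ?thesis
        using True \<beta>Suc[of "r i"] r(1)[of i] fk[OF r(1)[of i]] \<beta>c fc n
        by (simp add: r_Suc m_assoc[symmetric])
    next
      case False
      then show ?thesis
        using \<beta>Suc[of "r i"] r(1)[of i] \<beta>c[of "r i"] \<beta>c[of "Suc (r i)"] by (simp add: r_Suc)
    qed
    show "fst (comm ?W c d \<otimes>\<^bsub>?W\<^esub> (a \<otimes>\<^bsub>?W\<^esub> b)) = fst (b \<otimes>\<^bsub>?W\<^esub> a)"
      using comm_shift_group_zero[OF W(3,4)] *
      by (simp add: mult_shift_group a_def b_def c_def d_def)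
    show "snd (comm ?W c d \<otimes>\<^bsub>?W\<^esub> (a \<otimes>\<^bsub>?W\<^esub> b)) = snd (b \<otimes>\<^bsub>?W\<^esub> a)"
      using comm_shift_group_zero[OF W(3,4)]
      by (simp add: mult_shift_group a_def b_def c_def d_def)
  qed
  then have "comm ?W c d = b \<otimes>\<^bsub>?W\<^esub> a \<otimes>\<^bsub>?W\<^esub> inv\<^bsub>?W\<^esub> (a \<otimes>\<^bsub>?W\<^esub> b)"
    using W by (metis W.comm_closed W.inv_solve_right W.m_closed)
  then have relW: "comm ?W a b \<otimes>\<^bsub>?W\<^esub> comm ?W c d = \<one>\<^bsub>?W\<^esub>"
    using W by (simp add: comm_def[of ?W a b] W.inv_mult_group W.m_assoc)
  define h where "h = (!) [a, b, c, d]"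
  have hc: "h i \<in> carrier ?W" if "i < 4" for i
    using that W by (auto simp: h_def less_Suc_eq numeral_eq_Suc)
  let ?F4 = "free_group 4"
  interpret F4: group ?F4 by (rule group_free_group)
  interpret F: group F unfolding F_def by (rule group_free_group)
  interpret \<Psi>: group_hom ?F4 ?W "feval ?W h"
    using W.feval_hom[of 4 h] hc by unfold_locales auto
  have gc: "fgen 0 \<in> carrier ?F4" "fgen 1 \<in> carrier ?F4" "fgen 2 \<in> carrier ?F4" "fgen 3 \<in> carrier ?F4"
    by (auto intro: fgen_carrier)
  interpret cov: group_hom F ?F4 cov
    unfolding F_def cov_def using gc
    by (intro group_hom.intro group_hom_axioms.intro group_free_group F4.feval_hom F4.cover_gens_closed)
  have hg: "feval ?W h (fgen 0) = a" "feval ?W h (fgen 1) = b"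
      "feval ?W h (fgen 2) = c" "feval ?W h (fgen 3) = d"
    using W by (simp_all add: W.feval_fgen h_def)
  have "feval ?W h (surface_word 2) = \<one>\<^bsub>?W\<^esub>"
    using hom_surface_word_2[OF W.is_group \<Psi>.homh] relW unfolding hg by simp
  then have one: "feval ?W h (cov v) = \<one>\<^bsub>?W\<^esub>"
    using normal_closure_kernel[OF F4.is_group W.is_group \<Psi>.homh _ _ v(2)]
      surface_word_carrier[of 2] by simp
  have pow: "snd (a [^]\<^bsub>?W\<^esub> k) = int k \<and> fst (a [^]\<^bsub>?W\<^esub> k) 0 = (if k = n then f 0 else \<one>)"
    if "k \<le> n" for k
    using that
  proof (induction k)
    case 0
    then show ?case using n by (simp add: one_shift_group)
  next
    case (Suc k)
    then show ?case using fc r_small[of k] by (auto simp: mult_shift_group a_def)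
  qed
  define Z where "Z i = feval ?W h (cov (fgen i))" for i
  have Z: "Z i = cover_gens ?W n a b c d i" if "i < 2 * Suc n" for i
  proof -
    have "cov (fgen i) = cover_gens ?F4 n (fgen 0) (fgen 1) (fgen 2) (fgen 3) i"
      unfolding cov_def using gc by (intro F4.feval_fgen F4.cover_gens_closed)
    then show ?thesis
      using gc hg by (simp add: Z_def cover_gens_def \<Psi>.hom_nat_pow)
  qed
  have Zc: "Z i \<in> carrier ?W" if "i < 2 * Suc n" for i
    unfolding Z[OF that] by (rule W.cover_gens_closed[OF W])
  have Z0: "int n dvd snd (Z i) \<and> fst (Z i) 0 = f i" if i: "i < 2 * Suc n" for i
  proof -
    consider "i = 0" | "i = 1" | k where "k < n" "i = Suc (Suc (2 * k))"
      | k where "k < n" "i = Suc (Suc (Suc (2 * k)))"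
    proof -
      assume 1: "i = 0 \<Longrightarrow> thesis" "i = 1 \<Longrightarrow> thesis"
        "\<And>k. k < n \<Longrightarrow> i = Suc (Suc (2 * k)) \<Longrightarrow> thesis"
        "\<And>k. k < n \<Longrightarrow> i = Suc (Suc (Suc (2 * k))) \<Longrightarrow> thesis"
      show thesis
      proof (cases "i < 2")
        case True
        then show ?thesis using 1 by (auto simp: less_Suc_eq numeral_2_eq_2)
      next
        case False
        then show ?thesis
          using i 1(3,4)[of "i div 2 - 1"] by (cases "even i") (auto elim!: evenE oddE)
      qed
    qed
    then show ?thesis
    proof cases
      case 1
      then show ?thesis using Z[OF i] pow[of n] by simp
    next
      case 2
      then show ?thesis using Z[OF i] r_small[of 0] n \<beta>0 by (simp add: b_def)
    next
      case (3 k)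
      then show ?thesis
        using Z[OF i] pow[of k] W fk[of k] r_small[of k]
        by (simp add: W.nat_pow_closed inv_shift_group mult_shift_group c_def)
    next
      case (4 k)
      then show ?thesis
        using Z[OF i] pow[of k] W fk[of k] r_small[of k]
        by (simp add: W.nat_pow_closed inv_shift_group mult_shift_group d_def)
    qed
  qed
  interpret ev: group_hom F G "feval G f"
    unfolding F_def using f
    by (intro group_hom.intro group_hom_axioms.intro group_free_group is_group feval_hom)
  \<comment> \<open>The images of the cover generators have shifts divisible by \<open>n\<close>, so
    they fix coset 0. On such elements the coordinate at 0 is multiplicative, and on the generators
    it equals \<open>f i\<close>.\<close>
  have "int n dvd snd (feval ?W h (cov v)) \<and> fst (feval ?W h (cov v)) 0 = feval G f v"
    using v(1) unfolding F_def
  proof (induction rule: free_group_induct)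
    case one
    have "feval ?W h (cov []) = \<one>\<^bsub>?W\<^esub>"
      using cov.hom_one \<Psi>.hom_one by (simp add: F_def one_free_group)
    then show ?case by (simp add: one_shift_group)
  next
    case (gen i w)
    then have wc: "w \<in> carrier F" "fgen i \<in> carrier F" by (auto simp: F_def intro: fgen_carrier)
    let ?w = "feval ?W h (cov w)"
    have "?w \<in> carrier ?W" using wc by simp
    then have w: "fst ?w (snd (Z i)) = feval G f w"
      using gen Z0[OF gen(1)] shift_group_period[of ?w G n "snd (Z i)" 0] by simp
    have "int n dvd snd (Z i \<otimes>\<^bsub>?W\<^esub> ?w) \<and> fst (Z i \<otimes>\<^bsub>?W\<^esub> ?w) 0 = f i \<otimes> feval G f w"
      using gen Z0[OF gen(1)] w by (simp add: mult_shift_group)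
    moreover have "feval ?W h (cov (fgen i \<otimes>\<^bsub>F\<^esub> w)) = Z i \<otimes>\<^bsub>?W\<^esub> ?w"
      using wc by (simp add: Z_def)
    moreover have "feval G f (fgen i \<otimes>\<^bsub>F\<^esub> w) = f i \<otimes> feval G f w"
      using wc f[OF gen(1)] by (simp add: feval_fgen)
    ultimately show ?case unfolding F_def by simp
  next
    case (inv i w)
    then have wc: "w \<in> carrier F" "fgen i \<in> carrier F" by (auto simp: F_def intro: fgen_carrier)
    let ?w = "feval ?W h (cov w)"
    have "?w \<in> carrier ?W" using wc by simp
    then have w: "fst ?w (- snd (Z i)) = feval G f w"
      using inv Z0[OF inv(1)] shift_group_period[of ?w G n "- snd (Z i)" 0] by simp
    have z: "fst (Z i) (- snd (Z i)) = f i"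
      using shift_group_period[OF Zc[OF inv(1)], of "- snd (Z i)" 0] Z0[OF inv(1)] by simp
    have "int n dvd snd (inv\<^bsub>?W\<^esub> Z i \<otimes>\<^bsub>?W\<^esub> ?w)
        \<and> fst (inv\<^bsub>?W\<^esub> Z i \<otimes>\<^bsub>?W\<^esub> ?w) 0 = inv (f i) \<otimes> feval G f w"
      using inv Z0[OF inv(1)] w z by (simp add: inv_shift_group[OF Zc[OF inv(1)]] mult_shift_group)
    moreover have "feval ?W h (cov (inv\<^bsub>F\<^esub> (fgen i) \<otimes>\<^bsub>F\<^esub> w)) = inv\<^bsub>?W\<^esub> Z i \<otimes>\<^bsub>?W\<^esub> ?w"
      using wc by (simp add: Z_def)
    moreover have "feval G f (inv\<^bsub>F\<^esub> (fgen i) \<otimes>\<^bsub>F\<^esub> w) = inv (f i) \<otimes> feval G f w"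
      using wc f[OF inv(1)] by (simp add: feval_fgen)
    ultimately show ?case unfolding F_def by simp
  qed
  then show ?thesis using one by (simp add: one_shift_group)
qed

section \<open>A free group of integral matrices\<close>

text \<open>\<open>(p, q, r, s)\<close> stands for the matrix with rows \<open>(p, q)\<close> and \<open>(r, s)\<close>. The condition modulo 4
  excludes the negatives of the elements of the group.\<close>

type_synonym mat2 = "int \<times> int \<times> int \<times> int"

definition sanov :: "mat2 monoid" where
  "sanov =
     \<lparr> carrier = {(p, q, r, s). p * s - q * r = 1 \<and> p mod 4 = 1 \<and> s mod 4 = 1 \<and> even q \<and> even r},
       monoid.mult = (\<lambda>(p, q, r, s) (p', q', r', s').
          (p * p' + q * r', p * q' + q * s', r * p' + s * r', r * q' + s * s')),
       one = (1, 0, 0, 1) \<rparr>"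

lemma carrier_sanov:
  "(p, q, r, s) \<in> carrier sanov \<longleftrightarrow>
     p * s - q * r = 1 \<and> p mod 4 = 1 \<and> s mod 4 = 1 \<and> even q \<and> even r"
  by (simp add: sanov_def)

lemma mult_sanov:
  "(p, q, r, s) \<otimes>\<^bsub>sanov\<^esub> (p', q', r', s')
     = (p * p' + q * r', p * q' + q * s', r * p' + s * r', r * q' + s * s')"
  by (simp add: sanov_def)

lemma one_sanov: "\<one>\<^bsub>sanov\<^esub> = (1, 0, 0, 1)"
  by (simp add: sanov_def)

lemma mod4_mult_add:
  fixes p p' q r :: int
  assumes "p mod 4 = 1" "p' mod 4 = 1" "even q" "even r"
  shows "(p * p' + q * r) mod 4 = 1"
proof -
  obtain b c where "q = 2 * b" "r = 2 * c" using assms by (auto elim!: evenE)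
  then have "(p * p' + q * r) mod 4 = (p * p' + 4 * (b * c)) mod 4" by (simp add: algebra_simps)
  also have "\<dots> = ((p mod 4) * (p' mod 4)) mod 4" by (simp add: mod_mult_eq)
  finally show ?thesis using assms by simp
qed

lemma group_sanov: "group sanov"
proof (rule groupI)
  fix x y z assume "x \<in> carrier sanov" "y \<in> carrier sanov" "z \<in> carrier sanov"
  show "x \<otimes>\<^bsub>sanov\<^esub> y \<otimes>\<^bsub>sanov\<^esub> z = x \<otimes>\<^bsub>sanov\<^esub> (y \<otimes>\<^bsub>sanov\<^esub> z)"
    by (cases x; cases y; cases z) (simp add: mult_sanov algebra_simps)
next
  fix x y assume x: "x \<in> carrier sanov" and y: "y \<in> carrier sanov"
  obtain p q r s where xe: "x = (p, q, r, s)" by (cases x)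
  obtain p' q' r' s' where ye: "y = (p', q', r', s')" by (cases y)
  have c: "p * s - q * r = 1" "p mod 4 = 1" "s mod 4 = 1" "even q" "even r"
      "p' * s' - q' * r' = 1" "p' mod 4 = 1" "s' mod 4 = 1" "even q'" "even r'"
    using x y by (auto simp: xe ye carrier_sanov)
  have "(p * p' + q * r') * (r * q' + s * s') - (p * q' + q * s') * (r * p' + s * r')
      = (p * s - q * r) * (p' * s' - q' * r')" by (simp add: algebra_simps)
  moreover have "(r * q' + s * s') mod 4 = 1"
    using mod4_mult_add[of s s' r q'] c by (simp add: add.commute)
  ultimately show "x \<otimes>\<^bsub>sanov\<^esub> y \<in> carrier sanov"
    using c mod4_mult_add[of p p' q r'] by (simp add: xe ye mult_sanov carrier_sanov)
next
  fix x assume x: "x \<in> carrier sanov"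
  obtain p q r s where xe: "x = (p, q, r, s)" by (cases x)
  show "\<one>\<^bsub>sanov\<^esub> \<otimes>\<^bsub>sanov\<^esub> x = x" by (simp add: xe mult_sanov one_sanov)
  show "\<exists>y\<in>carrier sanov. y \<otimes>\<^bsub>sanov\<^esub> x = \<one>\<^bsub>sanov\<^esub>"
  proof
    show "(s, - q, - r, p) \<in> carrier sanov"
      using x by (simp add: xe carrier_sanov algebra_simps)
    show "(s, - q, - r, p) \<otimes>\<^bsub>sanov\<^esub> x = \<one>\<^bsub>sanov\<^esub>"
      using x by (simp add: xe carrier_sanov mult_sanov one_sanov algebra_simps)
  qed
qed (simp add: carrier_sanov one_sanov)

interpretation sanov: group sanov
  by (rule group_sanov)

lemma inv_sanov:
  assumes "(p, q, r, s) \<in> carrier sanov"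
  shows "inv\<^bsub>sanov\<^esub> (p, q, r, s) = (s, - q, - r, p)"
  by (rule sanov.inv_equality)
    (use assms in \<open>auto simp: carrier_sanov mult_sanov one_sanov algebra_simps\<close>)

section \<open>Action on the real plane and freeness by ping-pong\<close>

fun act :: "mat2 \<Rightarrow> real \<times> real \<Rightarrow> real \<times> real" where
  "act (p, q, r, s) (x, y) = (of_int p * x + of_int q * y, of_int r * x + of_int s * y)"

lemma act_mult: "act (m \<otimes>\<^bsub>sanov\<^esub> m') v = act m (act m' v)"
  by (cases m; cases m'; cases v) (simp add: mult_sanov algebra_simps)

lemma act_one [simp]: "act \<one>\<^bsub>sanov\<^esub> v = v"
  by (cases v) (simp add: one_sanov)

lemma act_inv [simp]:
  assumes "m \<in> carrier sanov"
  shows "act m (act (inv\<^bsub>sanov\<^esub> m) v) = v" "act (inv\<^bsub>sanov\<^esub> m) (act m v) = v"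
  using assms by (simp_all add: act_mult[symmetric])

definition sanov_gen :: "nat \<Rightarrow> mat2" where
  "sanov_gen i = (if i = 0 then (1, 2, 0, 1) else (1, 0, 2, 1))"

lemma sanov_gen_carrier [simp]: "sanov_gen i \<in> carrier sanov"
  by (simp add: sanov_gen_def carrier_sanov)

abbreviation sanov_rep :: "fword \<Rightarrow> mat2" where
  "sanov_rep \<equiv> feval sanov sanov_gen"

text \<open>Four open double sectors bounded by the axes and the diagonals: the larger absolute
  value is that of \<open>x\<close> for generator 0 and that of \<open>y\<close> otherwise, and the
  sign of \<open>x * y\<close> is the sign of the exponent.\<close>

fun ping_pong_region :: "nat \<times> bool \<Rightarrow> real \<times> real \<Rightarrow> bool" where
  "ping_pong_region (i, b) (x, y) =
     (if i = 0 then (if b then x > y \<and> y > 0 \<or> x < y \<and> y < 0 else x > - y \<and> - y > 0 \<or> x < - y \<and> - y < 0)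
      else (if b then y > x \<and> x > 0 \<or> y < x \<and> x < 0 else y > - x \<and> - x > 0 \<or> y < - x \<and> - x < 0))"

text \<open>Each letter maps every sector except that of its inverse into its own. The start vector
  lies on the axis not fixed by the last letter, which therefore throws it into a sector. Axis
  points lie in no sector, so a nonempty reduced word cannot act trivially.\<close>

lemma ping_pong:
  assumes "freduced w" "w \<noteq> []" "\<forall>x\<in>set w. fst x < 2"
  shows "ping_pong_region (hd w)
    (act (sanov_rep w) (if fst (last w) = 0 then (0, 1) else (1, 0)))"
  using assms
proof (induction w rule: freduced.induct)
  case (2 x)
  obtain i b where x: "x = (i, b)" by (cases x)
  show ?case using 2
    by (auto simp: x sanov_gen_def inv_sanov carrier_sanov less_2_cases_iff one_sanov mult_sanov)
next
  case (3 x y ys)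
  let ?v = "act (sanov_rep (y # ys)) (if fst (last (y # ys)) = 0 then (0, 1) else (1, 0))"
  obtain i b where x: "x = (i, b)" by (cases x)
  obtain j c where y: "y = (j, c)" by (cases y)
  obtain v1 v2 where v: "?v = (v1, v2)" by (cases ?v)
  have ij: "i < 2" "j < 2" "\<not> (i = j \<and> b \<noteq> c)" using 3 x y by auto
  have reg: "ping_pong_region (j, c) (v1, v2)" using 3 v y by simp
  have "ping_pong_region (i, b)
      (act (if b then sanov_gen i else inv\<^bsub>sanov\<^esub> (sanov_gen i)) (v1, v2))"
    using ij reg
    by (auto simp: sanov_gen_def inv_sanov carrier_sanov less_2_cases_iff split: if_splits)
  then show ?case
    using v by (cases b) (simp_all add: act_mult x)
qed simp

lemma sanov_rep_faithful:
  assumes w: "w \<in> carrier (free_group 2)" and one: "sanov_rep w = \<one>\<^bsub>sanov\<^esub>"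
  shows "w = []"
proof (rule ccontr)
  assume "w \<noteq> []"
  then have "ping_pong_region (hd w)
      (act (sanov_rep w) (if fst (last w) = 0 then (0, 1) else (1, 0)))"
    using ping_pong w by (simp add: carrier_free_group)
  then show False unfolding one by (cases "hd w") (auto split: if_splits)
qed

section \<open>Powers of \<open>U\<close> and the Pell equation\<close>

lemma sqrt5_independent:
  fixes a b :: int
  assumes "a\<^sup>2 = 5 * b\<^sup>2"
  shows "a = 0"
  using assms
proof (induction "nat \<bar>a\<bar>" arbitrary: a b rule: less_induct)
  case less
  have five: "Factorial_Ring.prime (5::int)" by simp
  \<comment> \<open>Infinite descent: 5 divides \<open>a\<close> and then \<open>b\<close>, and
    dividing both by 5 gives a smaller solution.\<close>
  have "5 dvd a" using less(2) five by (metis dvd_triv_left prime_dvd_power)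
  then obtain c where c: "a = 5 * c" by blast
  then have b: "b\<^sup>2 = 5 * c\<^sup>2" using less(2) by (simp add: power_mult_distrib)
  then have "5 dvd b" using five by (metis dvd_triv_left prime_dvd_power)
  then obtain d where d: "b = 5 * d" by blast
  then have cd: "c\<^sup>2 = 5 * d\<^sup>2" using b by (simp add: power_mult_distrib)
  show ?case
  proof (rule ccontr)
    assume "a \<noteq> 0"
    then have "nat \<bar>c\<bar> < nat \<bar>a\<bar>" using c by auto
    from less(1)[OF this cd] show False using c \<open>a \<noteq> 0\<close> by simp
  qed
qed

lemma add_sqrt5_eq_0:
  fixes a b :: int
  assumes "of_int a + of_int b * sqrt 5 = (0::real)"
  shows "a = 0 \<and> b = 0"
proof -
  have "(of_int a)\<^sup>2 = (of_int b * sqrt 5)\<^sup>2"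
    using assms by (metis add_eq_0_iff2 power2_minus)
  then have "(of_int (a\<^sup>2) :: real) = of_int (5 * b\<^sup>2)" by (simp add: power_mult_distrib)
  then have "a = 0" using sqrt5_independent of_int_eq_iff by blast
  then show ?thesis using assms by simp
qed

definition U :: mat2 where "U = (21, - 8, 8, - 3)"

lemma U_carrier [simp]: "U \<in> carrier sanov"
  by (simp add: U_def carrier_sanov)

lemma comm_sanov_gen: "comm sanov (sanov_gen 0) (sanov_gen 1) = U"
  by (simp add: comm_def sanov_gen_def inv_sanov carrier_sanov mult_sanov U_def)

text \<open>The centralizer of \<open>U\<close> consists of these matrices, and \<open>pell_mat 9 4 = U\<close> corresponds to
  the fundamental solution of the equation \<open>P\<^sup>2 - 5 Q\<^sup>2 = 1\<close>.\<close>

definition pell_mat :: "int \<Rightarrow> int \<Rightarrow> mat2" where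
  "pell_mat P Q = (P + 3 * Q, - 2 * Q, 2 * Q, P - 3 * Q)"

text \<open>\<open>pell_mat P Q\<close> is \<open>P\<close> times the identity plus \<open>Q\<close>
  times a matrix whose square is 5 times the identity, so these matrices multiply like the numbers
  \<open>P + Q * sqrt 5\<close>, and the determinant is the norm.\<close>

lemma pell_mat_mult:
  "pell_mat P Q \<otimes>\<^bsub>sanov\<^esub> pell_mat P' Q' = pell_mat (P * P' + 5 * Q * Q') (P * Q' + Q * P')"
  by (simp add: pell_mat_def mult_sanov algebra_simps)

text \<open>Descent: multiplication by \<open>9 - 4 * sqrt 5\<close>, which corresponds to the
  inverse of \<open>U\<close>, turns a solution with positive \<open>Q\<close> into one with a
  smaller nonnegative \<open>Q\<close>.\<close>

lemma pell_mat_eq_pow: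
  assumes "P > 0" "P\<^sup>2 - 5 * (int Q)\<^sup>2 = 1"
  shows "\<exists>k::nat. pell_mat P (int Q) = U [^]\<^bsub>sanov\<^esub> k"
  using assms
proof (induction Q arbitrary: P rule: less_induct)
  case (less Q)
  show ?case
  proof (cases "Q = 0")
    case True
    then have "P = 1" using less by (simp add: power2_eq_1_iff)
    then have "pell_mat P (int Q) = U [^]\<^bsub>sanov\<^esub> (0::nat)" using True by (simp add: pell_mat_def one_sanov)
    then show ?thesis by blast
  next
    case False
    have eq: "P\<^sup>2 = 5 * (int Q)\<^sup>2 + 1" using less by simp
    have pos: "(int Q)\<^sup>2 \<ge> 1" using False by (simp add: power2_eq_square int_one_le_iff_zero_less)
    have "(2 * int Q)\<^sup>2 < P\<^sup>2" using eq pos by (simp add: power_mult_distrib)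
    then have "2 * int Q < P" by (rule power2_less_imp_less) (use less(2) in simp)
    have "P\<^sup>2 < (3 * int Q)\<^sup>2" using eq pos by (simp add: power_mult_distrib)
    then have "P < 3 * int Q" by (rule power2_less_imp_less) simp
    \<comment> \<open>The few values of \<open>P\<close> between \<open>2 * Q\<close> and
      \<open>3 * Q\<close> do not solve the equation for smaller \<open>Q\<close>. The bound makes
      \<open>16 * P\<^sup>2 = 80 * Q\<^sup>2 + 16\<close> at most \<open>81 * Q\<^sup>2\<close>,
      which keeps the new \<open>Q'\<close> nonnegative.\<close>
    have "Q \<ge> 4"
    proof (rule ccontr)
      assume "\<not> Q \<ge> 4"
      then have "Q = 1 \<or> Q = 2 \<or> Q = 3" using False by auto
      moreover have "P = 5" if "Q = 2" using \<open>2 * int Q < P\<close> \<open>P < 3 * int Q\<close> that by simp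
      moreover have "P = 7 \<or> P = 8" if "Q = 3" using \<open>2 * int Q < P\<close> \<open>P < 3 * int Q\<close> that by auto
      moreover have "Q \<noteq> 1" using \<open>2 * int Q < P\<close> \<open>P < 3 * int Q\<close> by auto
      ultimately have "P = 5 \<and> Q = 2 \<or> P = 7 \<and> Q = 3 \<or> P = 8 \<and> Q = 3" by blast
      then show False using eq by auto
    qed
    have "4 * P \<le> 9 * int Q"
    proof (rule power2_le_imp_le)
      have "(int Q)\<^sup>2 \<ge> 4\<^sup>2" using \<open>Q \<ge> 4\<close> by (intro power_mono) auto
      then show "(4 * P)\<^sup>2 \<le> (9 * int Q)\<^sup>2" using eq by (simp add: power_mult_distrib)
    qed simp
    define Q' where "Q' = nat (9 * int Q - 4 * P)"
    define P' where "P' = 9 * P - 20 * int Q"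
    have Q': "int Q' = 9 * int Q - 4 * P" using \<open>4 * P \<le> 9 * int Q\<close> by (simp add: Q'_def)
    have "Q' < Q" using Q' \<open>2 * int Q < P\<close> by linarith
    moreover have "(20 * int Q)\<^sup>2 < (9 * P)\<^sup>2" using eq pos by (simp add: power_mult_distrib)
    then have "20 * int Q < 9 * P" by (rule power2_less_imp_less) (use less(2) in simp)
    then have "P' > 0" by (simp add: P'_def)
    moreover have "P'\<^sup>2 - 5 * (int Q')\<^sup>2 = 1"
      using eq unfolding Q' P'_def by (simp add: power2_eq_square algebra_simps)
    ultimately obtain k where k: "pell_mat P' (int Q') = U [^]\<^bsub>sanov\<^esub> (k::nat)"
      using less.IH by blast
    have "pell_mat P (int Q) = pell_mat P' (int Q') \<otimes>\<^bsub>sanov\<^esub> pell_mat 9 4"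
      unfolding pell_mat_mult by (simp add: Q' P'_def algebra_simps)
    also have "pell_mat 9 4 = U" by (simp add: pell_mat_def U_def)
    finally have "pell_mat P (int Q) = U [^]\<^bsub>sanov\<^esub> Suc k" unfolding k by simp
    then show ?thesis by blast
  qed
qed

lemma pell_mat_carrier_eq_pow:
  assumes "pell_mat P Q \<in> carrier sanov"
  shows "\<exists>k::int. pell_mat P Q = U [^]\<^bsub>sanov\<^esub> k"
proof -
  have pell: "P\<^sup>2 - 5 * Q\<^sup>2 = 1" and mod: "(P + 3 * Q) mod 4 = 1"
    using assms by (auto simp: pell_mat_def carrier_sanov power2_eq_square algebra_simps)
  have pos: "\<exists>k::int. pell_mat P' Q' = U [^]\<^bsub>sanov\<^esub> k"
    if P': "P' > 0" and pell': "P'\<^sup>2 - 5 * Q'\<^sup>2 = 1" for P' Q'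
  proof -
    obtain k :: nat where k: "pell_mat P' \<bar>Q'\<bar> = U [^]\<^bsub>sanov\<^esub> k"
      using pell_mat_eq_pow[OF P', of "nat \<bar>Q'\<bar>"] pell' by auto
    show ?thesis
    proof (cases "Q' \<ge> 0")
      case True
      then show ?thesis using k by (metis abs_of_nonneg int_pow_int)
    next
      case False
      have "pell_mat P' \<bar>Q'\<bar> \<in> carrier sanov" unfolding k by simp
      then have "pell_mat P' Q' = inv\<^bsub>sanov\<^esub> (pell_mat P' \<bar>Q'\<bar>)"
        using False by (simp add: pell_mat_def inv_sanov)
      also have "\<dots> = U [^]\<^bsub>sanov\<^esub> (- int k)"
        unfolding k by (simp add: sanov.int_pow_neg int_pow_int)
      finally show ?thesis by blast
    qed
  qed
  \<comment> \<open>For negative \<open>P\<close> the negative matrix would be a power of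
    \<open>U\<close>; then \<open>P + 3 * Q\<close> and its negative would both be 1 modulo
    4.\<close>
  have "P > 0"
  proof (rule ccontr)
    assume "\<not> P > 0"
    moreover have "P \<noteq> 0" using pell by (auto, smt (verit) zero_le_power2)
    ultimately obtain k :: int where k: "pell_mat (- P) (- Q) = U [^]\<^bsub>sanov\<^esub> k"
      using pos[of "- P" "- Q"] pell by auto
    have "pell_mat (- P) (- Q) \<in> carrier sanov" unfolding k by simp
    then have "(- P + 3 * - Q) mod 4 = 1" by (simp add: pell_mat_def carrier_sanov)
    then show False using mod by presburger
  qed
  then show ?thesis using pos pell by blast
qed

section \<open>Eigenlines of \<open>U\<close> and growth along them\<close>

definition eig :: real where "eig = 9 + 4 * sqrt 5"
definition eig_inv :: real where "eig_inv = 9 - 4 * sqrt 5"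

text \<open>Coordinates, up to scalars, with respect to the eigenvectors of \<open>U\<close>.\<close>

fun eig_coord :: "real \<times> real \<Rightarrow> real" where "eig_coord (x, y) = (3 + sqrt 5) * x - 2 * y"
fun eig_inv_coord :: "real \<times> real \<Rightarrow> real" where "eig_inv_coord (x, y) = (3 - sqrt 5) * x - 2 * y"

lemma eig_mult: "eig * eig_inv = 1"
  by (simp add: eig_def eig_inv_def algebra_simps)

lemma eig_inv_bounds: "0 < eig_inv" "eig_inv < 1"
proof -
  have "sqrt 5 \<ge> 0" by simp
  then have 1: "eig > 1" unfolding eig_def by linarith
  then have 2: "eig_inv = 1 / eig" using eig_mult by (simp add: field_simps)
  show "0 < eig_inv" "eig_inv < 1" unfolding 2 using 1 by (simp_all add: field_simps)
qed

lemma eig_coords_U: "eig_coord (act U v) = eig * eig_coord v" "eig_inv_coord (act U v) = eig_inv * eig_inv_coord v"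
  by (cases v; simp add: U_def eig_def eig_inv_def algebra_simps)+

lemma eig_coords_U_pow:
  "eig_coord (act (U [^]\<^bsub>sanov\<^esub> (n::nat)) v) = eig ^ n * eig_coord v"
  "eig_inv_coord (act (U [^]\<^bsub>sanov\<^esub> n) v) = eig_inv ^ n * eig_inv_coord v"
  by (induction n arbitrary: v) (simp_all add: act_mult eig_coords_U)

lemma eig_coords_U_pow_inv:
  "eig_coord (act (inv\<^bsub>sanov\<^esub> (U [^]\<^bsub>sanov\<^esub> (n::nat))) v) = eig_inv ^ n * eig_coord v"
  "eig_inv_coord (act (inv\<^bsub>sanov\<^esub> (U [^]\<^bsub>sanov\<^esub> n)) v) = eig ^ n * eig_inv_coord v"
proof -
  let ?v = "act (inv\<^bsub>sanov\<^esub> (U [^]\<^bsub>sanov\<^esub> n)) v"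
  have "eig_coord v = eig ^ n * eig_coord ?v" "eig_inv_coord v = eig_inv ^ n * eig_inv_coord ?v"
    using eig_coords_U_pow[of n ?v] by simp_all
  moreover have "eig ^ n * eig_inv ^ n = 1" using eig_mult by (simp add: power_mult_distrib[symmetric])
  ultimately show "eig_coord ?v = eig_inv ^ n * eig_coord v" "eig_inv_coord ?v = eig ^ n * eig_inv_coord v"
    by (simp_all add: mult.assoc[symmetric] mult.commute)
qed

text \<open>An integral matrix preserving one of the two irrational eigenlines of \<open>U\<close> also preserves
  the conjugate one, so it commutes with \<open>U\<close>.\<close>

lemma sanov_eigen_coeffs:
  assumes "M \<in> carrier sanov" and "\<nexists>k::int. M = U [^]\<^bsub>sanov\<^esub> k"
  shows "\<exists>\<alpha> \<beta> \<gamma> \<delta>. \<beta> \<noteq> 0 \<and> \<gamma> \<noteq> 0 \<and>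
    (\<forall>v. eig_coord (act M v) = \<alpha> * eig_coord v + \<beta> * eig_inv_coord v \<and> eig_inv_coord (act M v) = \<gamma> * eig_coord v + \<delta> * eig_inv_coord v)"
proof -
  obtain p q r s where M: "M = (p, q, r, s)" by (cases M)
  define t where "t = sqrt 5"
  have tt: "t * t = 5" "t \<noteq> 0" by (simp_all add: t_def)
  \<comment> \<open>\<open>A + B * sqrt 5\<close> and its conjugate are, up to nonzero factors, the
    off-diagonal coefficients \<beta> and \<gamma> of \<open>M\<close> in the eigenbasis. As
    \<open>A\<close> and \<open>B\<close> are integers, either coefficient vanishes only if both
    \<open>A\<close> and \<open>B\<close> do, and then \<open>M\<close> has the shape of
    \<open>pell_mat\<close>.\<close>
  define A where "A = 6 * p - 4 * r + 14 * q - 6 * s"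
  define B where "B = 2 * p + 6 * q - 2 * s"
  have AB: "A \<noteq> 0 \<or> B \<noteq> 0"
  proof (rule ccontr)
    assume "\<not> ?thesis"
    then have "s = p + 3 * q" "r = - q" by (auto simp: A_def B_def)
    moreover from this obtain q' where q': "q = - 2 * q'"
      using assms(1) by (metis M carrier_sanov evenE minus_mult_commute minus_minus)
    ultimately have "M = pell_mat (p - 3 * q') q'" by (simp add: M pell_mat_def)
    then show False using pell_mat_carrier_eq_pow assms by metis
  qed
  have ne1: "of_int A + of_int B * t \<noteq> 0"
    using add_sqrt5_eq_0[of A B] AB unfolding t_def by blast
  have ne2: "of_int A - of_int B * t \<noteq> 0"
  proof
    assume "of_int A - of_int B * t = 0"
    then have "of_int A + of_int (- B) * sqrt 5 = (0::real)" by (simp add: t_def)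
    from add_sqrt5_eq_0[OF this] AB show False by simp
  qed
  define A1 where "A1 = (3 + t) * p - 2 * r"
  define A2 where "A2 = (3 + t) * q - 2 * s"
  define B1 where "B1 = (3 - t) * p - 2 * r"
  define B2 where "B2 = (3 - t) * q - 2 * s"
  \<comment> \<open>The coefficients result from expressing \<open>x\<close> and \<open>y\<close>
    through the two eigencoordinates, as in the facts \<open>x\<close> and \<open>y\<close>
    below.\<close>
  define \<alpha> where "\<alpha> = (2 * A1 + A2 * (3 - t)) / (4 * t)"
  define \<beta> where "\<beta> = - (2 * A1 + A2 * (3 + t)) / (4 * t)"
  define \<gamma> where "\<gamma> = (2 * B1 + B2 * (3 - t)) / (4 * t)"
  define \<delta> where "\<delta> = - (2 * B1 + B2 * (3 + t)) / (4 * t)"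
  have ttx: "t * (t * x) = 5 * x" for x using tt by (simp add: mult.assoc[symmetric])
  have "2 * A1 + A2 * (3 + t) = of_int A + of_int B * t"
    by (simp add: A1_def A2_def A_def B_def algebra_simps tt ttx)
  then have "\<beta> \<noteq> 0" using ne1 tt by (simp add: \<beta>_def)
  have "2 * B1 + B2 * (3 - t) = of_int A - of_int B * t"
    by (simp add: B1_def B2_def A_def B_def algebra_simps tt ttx)
  then have "\<gamma> \<noteq> 0" using ne2 tt by (simp add: \<gamma>_def)
  have "eig_coord (act M v) = \<alpha> * eig_coord v + \<beta> * eig_inv_coord v \<and> eig_inv_coord (act M v) = \<gamma> * eig_coord v + \<delta> * eig_inv_coord v" for v
  proof -
    obtain x y where v: "v = (x, y)" by (cases v)
    have f: "eig_coord v = (3 + t) * x - 2 * y" "eig_inv_coord v = (3 - t) * x - 2 * y" by (simp_all add: v t_def)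
    have x: "eig_coord v - eig_inv_coord v = 2 * t * x" unfolding f by (simp add: algebra_simps)
    have y: "(3 - t) * eig_coord v - (3 + t) * eig_inv_coord v = 4 * t * y" unfolding f by (simp add: algebra_simps)
    have "eig_coord (act M v) = A1 * x + A2 * y" "eig_inv_coord (act M v) = B1 * x + B2 * y"
      by (simp_all add: M v A1_def A2_def B1_def B2_def t_def algebra_simps)
    moreover have "\<alpha> * eig_coord v + \<beta> * eig_inv_coord v
        = (2 * A1 * (eig_coord v - eig_inv_coord v) + A2 * ((3 - t) * eig_coord v - (3 + t) * eig_inv_coord v)) / (4 * t)"
      using tt by (simp add: \<alpha>_def \<beta>_def field_simps)
    moreover have "\<gamma> * eig_coord v + \<delta> * eig_inv_coord v
        = (2 * B1 * (eig_coord v - eig_inv_coord v) + B2 * ((3 - t) * eig_coord v - (3 + t) * eig_inv_coord v)) / (4 * t)"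
      using tt by (simp add: \<gamma>_def \<delta>_def field_simps)
    moreover have "(2 * C * (2 * t * x) + D * (4 * t * y)) / (4 * t) = C * x + D * y" for C D
      using tt by (simp add: field_simps)
    ultimately show ?thesis by (simp only: x y)
  qed
  then show ?thesis using \<open>\<beta> \<noteq> 0\<close> \<open>\<gamma> \<noteq> 0\<close> by blast
qed

text \<open>Inductive step for the growth of the images of alternating products: each twisted factor
  contributes \<open>eig ^ (2 * n)\<close>, because it does not preserve an eigenline of \<open>U\<close>.\<close>

lemma twisted_factor_limit:
  assumes M: "M \<in> carrier sanov" "\<nexists>k::int. M = U [^]\<^bsub>sanov\<^esub> k"
    and s: "(\<lambda>n. eig_inv ^ (2 * m * n) * eig_coord (v n)) \<longlonglongrightarrow> a"
    and t: "(\<lambda>n. eig_inv ^ (2 * m * n) * eig_inv_coord (v n)) \<longlonglongrightarrow> b" and b: "b \<noteq> 0"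
  defines "w \<equiv> \<lambda>n. act (U [^]\<^bsub>sanov\<^esub> n \<otimes>\<^bsub>sanov\<^esub> M \<otimes>\<^bsub>sanov\<^esub> inv\<^bsub>sanov\<^esub> (U [^]\<^bsub>sanov\<^esub> n)) (v n)"
  shows "\<exists>c. c \<noteq> 0 \<and> (\<lambda>n. eig_inv ^ (2 * Suc m * n) * eig_coord (w n)) \<longlonglongrightarrow> c
    \<and> (\<lambda>n. eig_inv ^ (2 * Suc m * n) * eig_inv_coord (w n)) \<longlonglongrightarrow> 0"
proof -
  obtain \<alpha> \<beta> \<gamma> \<delta> where "\<beta> \<noteq> 0" and
    co: "\<And>v. eig_coord (act M v) = \<alpha> * eig_coord v + \<beta> * eig_inv_coord v" "\<And>v. eig_inv_coord (act M v) = \<gamma> * eig_coord v + \<delta> * eig_inv_coord v"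
    using sanov_eigen_coeffs[OF M] by blast
  let ?e = eig_inv
  \<comment> \<open>The inverse twist stretches the contracting coordinate of \<open>v n\<close>,
    \<beta> carries it over to the expanding coordinate, and the twist stretches it again. This term
    of order \<open>eig ^ (2 * n)\<close> dominates and has the normalised limit
    \<open>\<beta> * b\<close>.\<close>
  have fpw: "eig_coord (w n) = eig ^ n * (\<alpha> * (?e ^ n * eig_coord (v n)) + \<beta> * (eig ^ n * eig_inv_coord (v n)))" for n
    using M by (simp add: w_def act_mult eig_coords_U_pow eig_coords_U_pow_inv co)
  have fmw: "eig_inv_coord (w n) = ?e ^ n * (\<gamma> * (?e ^ n * eig_coord (v n)) + \<delta> * (eig ^ n * eig_inv_coord (v n)))" for n
    using M by (simp add: w_def act_mult eig_coords_U_pow eig_coords_U_pow_inv co)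
  have one: "eig ^ n * ?e ^ n = 1" for n using eig_mult by (simp add: power_mult_distrib[symmetric])
  have e2: "?e ^ (2 * Suc m * n) = ?e ^ (2 * m * n) * (?e ^ n * ?e ^ n)" for n
    by (simp add: power_add[symmetric] algebra_simps)
  have en: "(\<lambda>n. ?e ^ n) \<longlonglongrightarrow> 0"
    using eig_inv_bounds by (intro LIMSEQ_realpow_zero) auto
  have "?e ^ (2 * Suc m * n) * eig_coord (w n)
      = \<alpha> * (?e ^ n * ?e ^ n) * (?e ^ (2 * m * n) * eig_coord (v n)) + \<beta> * (?e ^ (2 * m * n) * eig_inv_coord (v n))" for n
  proof -
    have "?e ^ (2 * Suc m * n) * eig_coord (w n) = \<alpha> * ((eig ^ n * ?e ^ n) * (?e ^ n * ?e ^ n)) * (?e ^ (2 * m * n) * eig_coord (v n))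
        + \<beta> * ((eig ^ n * ?e ^ n) * (eig ^ n * ?e ^ n)) * (?e ^ (2 * m * n) * eig_inv_coord (v n))"
      unfolding e2 fpw by (simp add: algebra_simps)
    then show ?thesis unfolding one by simp
  qed
  moreover have "(\<lambda>n. \<alpha> * (?e ^ n * ?e ^ n) * (?e ^ (2 * m * n) * eig_coord (v n)) + \<beta> * (?e ^ (2 * m * n) * eig_inv_coord (v n)))
      \<longlonglongrightarrow> \<alpha> * (0 * 0) * a + \<beta> * b"
    by (intro tendsto_intros en s t)
  ultimately have 1: "(\<lambda>n. ?e ^ (2 * Suc m * n) * eig_coord (w n)) \<longlonglongrightarrow> \<beta> * b" by simp
  have "?e ^ (2 * Suc m * n) * eig_inv_coord (w n)
      = \<gamma> * (?e ^ n * ?e ^ n) * (?e ^ n * ?e ^ n) * (?e ^ (2 * m * n) * eig_coord (v n))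
        + \<delta> * (?e ^ n * ?e ^ n) * (?e ^ (2 * m * n) * eig_inv_coord (v n))" for n
  proof -
    have "?e ^ (2 * Suc m * n) * eig_inv_coord (w n) = \<gamma> * (?e ^ n * ?e ^ n) * (?e ^ n * ?e ^ n) * (?e ^ (2 * m * n) * eig_coord (v n))
        + \<delta> * (eig ^ n * ?e ^ n) * (?e ^ n * ?e ^ n) * (?e ^ (2 * m * n) * eig_inv_coord (v n))"
      unfolding e2 fmw by (simp add: algebra_simps)
    then show ?thesis unfolding one by simp
  qed
  moreover have "(\<lambda>n. \<gamma> * (?e ^ n * ?e ^ n) * (?e ^ n * ?e ^ n) * (?e ^ (2 * m * n) * eig_coord (v n))
        + \<delta> * (?e ^ n * ?e ^ n) * (?e ^ (2 * m * n) * eig_inv_coord (v n)))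
      \<longlonglongrightarrow> \<gamma> * (0 * 0) * (0 * 0) * a + \<delta> * (0 * 0) * b"
    by (intro tendsto_intros en s t)
  ultimately have 2: "(\<lambda>n. ?e ^ (2 * Suc m * n) * eig_inv_coord (w n)) \<longlonglongrightarrow> 0" by simp
  show ?thesis using 1 2 \<open>\<beta> \<noteq> 0\<close> b by (intro exI[of _ "\<beta> * b"]) simp
qed

section \<open>Amalgams of two copies of a free group\<close>

text \<open>The words consist of whole pairs \<open>b y\<close>, \<open>a x\<close>, so that each
  pair contains exactly one twisted factor. All factors avoid \<open>C\<close> except the final
  \<open>a x\<close>, which is unrestricted: the growth argument absorbs it into the start
  vector.\<close>

inductive_set alternating ::
  "('h, 'k) monoid_scheme \<Rightarrow> ('g, 'l) monoid_scheme \<Rightarrow> ('h \<Rightarrow> 'g) \<Rightarrow> ('h \<Rightarrow> 'g) \<Rightarrow> 'h set \<Rightarrow> 'g set"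
  for H G a b C
where
  single: "\<lbrakk>y \<in> carrier H; y \<notin> C; x \<in> carrier H\<rbrakk> \<Longrightarrow> b y \<otimes>\<^bsub>G\<^esub> a x \<in> alternating H G a b C"
| extend: "\<lbrakk>y \<in> carrier H; y \<notin> C; x \<in> carrier H; x \<notin> C; k \<in> alternating H G a b C\<rbrakk>
    \<Longrightarrow> b y \<otimes>\<^bsub>G\<^esub> (a x \<otimes>\<^bsub>G\<^esub> k) \<in> alternating H G a b C"

text \<open>Elements of a quotient of the free product of two copies of \<open>H\<close> in which the two copies of
  \<open>C\<close> are identified. Only the existence of this form matters, not its uniqueness.\<close>

definition has_normal_form ::
  "('h, 'k) monoid_scheme \<Rightarrow> ('g, 'l) monoid_scheme \<Rightarrow> ('h \<Rightarrow> 'g) \<Rightarrow> ('h \<Rightarrow> 'g) \<Rightarrow> 'h set \<Rightarrow> 'g \<Rightarrow> bool"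
where
  "has_normal_form H G a b C g \<longleftrightarrow>
     (\<exists>x\<in>carrier H. g = a x \<or> (\<exists>k\<in>alternating H G a b C. g = a x \<otimes>\<^bsub>G\<^esub> k))"

context
  fixes H :: "('h, 'k) monoid_scheme" and G :: "('g, 'l) monoid_scheme"
    and a b :: "'h \<Rightarrow> 'g" and C :: "'h set"
  assumes H: "group H" and G: "group G" and a: "a \<in> hom H G" and b: "b \<in> hom H G"
    and C: "C \<subseteq> carrier H" and agree: "\<And>c. c \<in> C \<Longrightarrow> a c = b c"
begin

interpretation a: group_hom H G a
  using H G a by (simp add: group_hom_def group_hom_axioms_def)
interpretation b: group_hom H G b
  using H G b by (simp add: group_hom_def group_hom_axioms_def)

lemma alternating_closed: "k \<in> alternating H G a b C \<Longrightarrow> k \<in> carrier G"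
  by (induction rule: alternating.induct) auto

lemma has_normal_form_left_a:
  assumes "has_normal_form H G a b C g" "z \<in> carrier H"
  shows "has_normal_form H G a b C (a z \<otimes>\<^bsub>G\<^esub> g)"
proof -
  obtain x where x: "x \<in> carrier H" "g = a x \<or> (\<exists>k\<in>alternating H G a b C. g = a x \<otimes>\<^bsub>G\<^esub> k)"
    using assms(1) unfolding has_normal_form_def by blast
  have c: "z \<otimes>\<^bsub>H\<^esub> x \<in> carrier H" using x assms by simp
  from x(2) show ?thesis
  proof
    assume "g = a x"
    then have "a z \<otimes>\<^bsub>G\<^esub> g = a (z \<otimes>\<^bsub>H\<^esub> x)" using x assms by simp
    then show ?thesis using c unfolding has_normal_form_def by blast
  next
    assume "\<exists>k\<in>alternating H G a b C. g = a x \<otimes>\<^bsub>G\<^esub> k"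
    then obtain k where k: "k \<in> alternating H G a b C" "g = a x \<otimes>\<^bsub>G\<^esub> k" by blast
    have "a z \<otimes>\<^bsub>G\<^esub> g = a (z \<otimes>\<^bsub>H\<^esub> x) \<otimes>\<^bsub>G\<^esub> k"
      using x assms k alternating_closed[OF k(1)] by (simp add: a.H.m_assoc)
    then show ?thesis using c k(1) unfolding has_normal_form_def by blast
  qed
qed

lemma has_normal_form_alternating:
  "k \<in> alternating H G a b C \<Longrightarrow> has_normal_form H G a b C k"
  unfolding has_normal_form_def using alternating_closed
  by (intro bexI[of _ "\<one>\<^bsub>H\<^esub>"] disjI2 bexI[of _ k]) simp_all

text \<open>If \<open>z\<close> is in \<open>C\<close>, it is read as a factor \<open>a z\<close>.
  Otherwise a leading \<open>a x\<close> with \<open>x \<in> C\<close> that is followed by some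
  \<open>b y\<close> is read as \<open>b x\<close> and merged with its neighbours \<open>b z\<close>
  and \<open>b y\<close>. Should the merged factor fall into \<open>C\<close>, it moves to the
  \<open>a\<close> side and the word loses a pair.\<close>

lemma has_normal_form_left_b:
  assumes g: "has_normal_form H G a b C g" and z: "z \<in> carrier H"
  shows "has_normal_form H G a b C (b z \<otimes>\<^bsub>G\<^esub> g)"
proof (cases "z \<in> C")
  case True
  then show ?thesis using has_normal_form_left_a[OF g z] agree by simp
next
  case False
  obtain x where x: "x \<in> carrier H" "g = a x \<or> (\<exists>k\<in>alternating H G a b C. g = a x \<otimes>\<^bsub>G\<^esub> k)"
    using g unfolding has_normal_form_def by blast
  from x(2) show ?thesis
  proof
    assume "g = a x"
    then show ?thesis
      using alternating.single[OF z False x(1)] has_normal_form_alternating by metis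
  next
    assume "\<exists>k\<in>alternating H G a b C. g = a x \<otimes>\<^bsub>G\<^esub> k"
    then obtain k where k: "k \<in> alternating H G a b C" "g = a x \<otimes>\<^bsub>G\<^esub> k" by blast
    show ?thesis
    proof (cases "x \<in> C")
      case False': False
      then show ?thesis
        using alternating.extend[OF z False x(1) False' k(1)] k(2) has_normal_form_alternating by metis
    next
      case True
      then have ax: "a x = b x" by (rule agree)
      from k(1) show ?thesis
      proof cases
        case (single y x')
        have y': "z \<otimes>\<^bsub>H\<^esub> x \<otimes>\<^bsub>H\<^esub> y \<in> carrier H" using z x single by simp
        have eq: "b z \<otimes>\<^bsub>G\<^esub> g = b (z \<otimes>\<^bsub>H\<^esub> x \<otimes>\<^bsub>H\<^esub> y) \<otimes>\<^bsub>G\<^esub> a x'"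
          using single z x by (simp add: k(2) ax a.H.m_assoc)
        have "has_normal_form H G a b C (a x')" using single(4) unfolding has_normal_form_def by blast
        note rest = this
        show ?thesis
        proof (cases "z \<otimes>\<^bsub>H\<^esub> x \<otimes>\<^bsub>H\<^esub> y \<in> C")
          case True
          show ?thesis
            unfolding eq agree[OF True, symmetric] by (rule has_normal_form_left_a[OF rest y'])
        next
          case False
          show ?thesis
            unfolding eq
            by (rule has_normal_form_alternating[OF alternating.single[OF y' False single(4)]])
        qed
      next
        case (extend y x' k')
        have y': "z \<otimes>\<^bsub>H\<^esub> x \<otimes>\<^bsub>H\<^esub> y \<in> carrier H" using z x extend by simp
        have k': "k' \<in> carrier G" by (rule alternating_closed[OF extend(6)])
        have eq: "b z \<otimes>\<^bsub>G\<^esub> g = b (z \<otimes>\<^bsub>H\<^esub> x \<otimes>\<^bsub>H\<^esub> y) \<otimes>\<^bsub>G\<^esub> (a x' \<otimes>\<^bsub>G\<^esub> k')"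
          using extend(1-5) z x k' by (simp add: k(2) ax a.H.m_assoc)
        have "has_normal_form H G a b C (a x' \<otimes>\<^bsub>G\<^esub> k')"
          using extend(4,6) unfolding has_normal_form_def by blast
        note rest = this
        show ?thesis
        proof (cases "z \<otimes>\<^bsub>H\<^esub> x \<otimes>\<^bsub>H\<^esub> y \<in> C")
          case True
          show ?thesis
            unfolding eq agree[OF True, symmetric] by (rule has_normal_form_left_a[OF rest y'])
        next
          case False
          show ?thesis
            unfolding eq
            by (rule has_normal_form_alternating[OF alternating.extend[OF y' False extend(4-6)]])
        qed
      qed
    qed
  qed
qed

text \<open>The exponent counts twisted factors, and the limits say that the image direction tends
  to the expanding eigenline of \<open>U\<close>. An untwisted factor outside \<open>C\<close> moves
  this line off itself because \<gamma> is nonzero, which supplies the contracting coordinate that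
  the next twisted factor amplifies.\<close>

lemma alternating_growth:
  fixes \<theta> :: "nat \<Rightarrow> 'g \<Rightarrow> mat2" and \<rho> :: "'h \<Rightarrow> mat2"
  assumes \<theta>: "\<And>n. \<theta> n \<in> hom G sanov" and \<rho>: "\<rho> \<in> hom H sanov"
    and \<theta>a: "\<And>n x. x \<in> carrier H \<Longrightarrow> \<theta> n (a x) = \<rho> x"
    and \<theta>b: "\<And>n x. x \<in> carrier H \<Longrightarrow> \<theta> n (b x)
      = U [^]\<^bsub>sanov\<^esub> n \<otimes>\<^bsub>sanov\<^esub> \<rho> x \<otimes>\<^bsub>sanov\<^esub> inv\<^bsub>sanov\<^esub> (U [^]\<^bsub>sanov\<^esub> n)"
    and \<rho>C: "\<And>x. x \<in> carrier H \<Longrightarrow> x \<notin> C \<Longrightarrow> \<nexists>k::int. \<rho> x = U [^]\<^bsub>sanov\<^esub> k"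
    and k: "k \<in> alternating H G a b C"
  shows "\<exists>v m c. c \<noteq> 0 \<and> (\<lambda>n. eig_inv ^ (2 * Suc m * n) * eig_coord (act (\<theta> n k) v)) \<longlonglongrightarrow> c
    \<and> (\<lambda>n. eig_inv ^ (2 * Suc m * n) * eig_inv_coord (act (\<theta> n k) v)) \<longlonglongrightarrow> 0"
  using k
proof (induction rule: alternating.induct)
  case (single y x)
  have \<rho>c: "\<rho> x \<in> carrier sanov" "\<rho> y \<in> carrier sanov" using \<rho> single by (auto simp: hom_def)
  \<comment> \<open>\<open>e\<close> spans the contracting eigenline of \<open>U\<close>, so the
    constant sequence \<open>e\<close> meets the hypotheses of \<open>twisted_factor_limit\<close>
    with \<open>m = 0\<close>. The start vector \<open>v\<close> is what the final factor
    \<open>a x\<close> maps to \<open>e\<close>, for every \<open>n\<close>.\<close>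
  define e :: "real \<times> real" where "e = (2, 3 + sqrt 5)"
  have e: "eig_coord e = 0" "eig_inv_coord e \<noteq> 0" by (simp_all add: e_def algebra_simps)
  define v where "v = act (inv\<^bsub>sanov\<^esub> \<rho> x) e"
  have "act (\<theta> n (b y \<otimes>\<^bsub>G\<^esub> a x)) v
      = act (U [^]\<^bsub>sanov\<^esub> n \<otimes>\<^bsub>sanov\<^esub> \<rho> y \<otimes>\<^bsub>sanov\<^esub> inv\<^bsub>sanov\<^esub> (U [^]\<^bsub>sanov\<^esub> n)) e" for n
    using hom_mult[OF \<theta>, of "b y" "a x" n] single \<rho>c
    by (simp add: \<theta>a \<theta>b act_mult v_def)
  then show ?case
    using twisted_factor_limit[OF \<rho>c(2) \<rho>C[OF single(1,2)], of 0 "\<lambda>n. e" 0 "eig_inv_coord e"] e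
    by (intro exI[where x = v] exI[where x = "0::nat"]) simp
next
  case (extend y x k)
  have \<rho>c: "\<rho> x \<in> carrier sanov" "\<rho> y \<in> carrier sanov" using \<rho> extend by (auto simp: hom_def)
  from extend.IH obtain v m c where c: "c \<noteq> 0"
    and eig_coord: "(\<lambda>n. eig_inv ^ (2 * Suc m * n) * eig_coord (act (\<theta> n k) v)) \<longlonglongrightarrow> c"
    and eig_inv_coord: "(\<lambda>n. eig_inv ^ (2 * Suc m * n) * eig_inv_coord (act (\<theta> n k) v)) \<longlonglongrightarrow> 0" by blast
  obtain \<alpha> \<beta> \<gamma> \<delta> where "\<gamma> \<noteq> 0" and
    co: "\<And>v. eig_coord (act (\<rho> x) v) = \<alpha> * eig_coord v + \<beta> * eig_inv_coord v" "\<And>v. eig_inv_coord (act (\<rho> x) v) = \<gamma> * eig_coord v + \<delta> * eig_inv_coord v"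
    using sanov_eigen_coeffs[OF \<rho>c(1) \<rho>C[OF extend(3,4)]] by blast
  let ?w = "\<lambda>n. act (\<rho> x) (act (\<theta> n k) v)"
  have "(\<lambda>n. \<alpha> * (eig_inv ^ (2 * Suc m * n) * eig_coord (act (\<theta> n k) v))
      + \<beta> * (eig_inv ^ (2 * Suc m * n) * eig_inv_coord (act (\<theta> n k) v))) \<longlonglongrightarrow> \<alpha> * c + \<beta> * 0"
    by (intro tendsto_intros eig_coord eig_inv_coord)
  then have 1: "(\<lambda>n. eig_inv ^ (2 * Suc m * n) * eig_coord (?w n)) \<longlonglongrightarrow> \<alpha> * c"
    by (simp add: co algebra_simps)
  have "(\<lambda>n. \<gamma> * (eig_inv ^ (2 * Suc m * n) * eig_coord (act (\<theta> n k) v))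
      + \<delta> * (eig_inv ^ (2 * Suc m * n) * eig_inv_coord (act (\<theta> n k) v))) \<longlonglongrightarrow> \<gamma> * c + \<delta> * 0"
    by (intro tendsto_intros eig_coord eig_inv_coord)
  then have 2: "(\<lambda>n. eig_inv ^ (2 * Suc m * n) * eig_inv_coord (?w n)) \<longlonglongrightarrow> \<gamma> * c"
    by (simp add: co algebra_simps)
  have kc: "k \<in> carrier G" by (rule alternating_closed[OF extend(5)])
  have "act (\<theta> n (b y \<otimes>\<^bsub>G\<^esub> (a x \<otimes>\<^bsub>G\<^esub> k))) v
      = act (U [^]\<^bsub>sanov\<^esub> n \<otimes>\<^bsub>sanov\<^esub> \<rho> y \<otimes>\<^bsub>sanov\<^esub> inv\<^bsub>sanov\<^esub> (U [^]\<^bsub>sanov\<^esub> n)) (?w n)" for n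
    using hom_mult[OF \<theta>, of "b y" "a x \<otimes>\<^bsub>G\<^esub> k" n] hom_mult[OF \<theta>, of "a x" k n] extend(1,3) kc
    by (simp add: \<theta>a \<theta>b act_mult)
  then show ?case
    using twisted_factor_limit[OF \<rho>c(2) \<rho>C[OF extend(1,2)] 1 2] c \<open>\<gamma> \<noteq> 0\<close>
    by (intro exI[where x = v] exI[where x = "Suc m"]) simp
qed

text \<open>If every \<open>\<theta> n\<close> kills \<open>a x \<otimes> k\<close>, then the image
  of \<open>k\<close> is \<open>inv (\<rho> x)\<close>, independently of \<open>n\<close>. Its
  normalised expanding coordinate tends to 0, against the nonzero limit in
  \<open>alternating_growth\<close>. If there is no alternating part, injectivity of \<rho>
  decides.\<close>

lemma has_normal_form_detect:
  fixes \<theta> :: "nat \<Rightarrow> 'g \<Rightarrow> mat2" and \<rho> :: "'h \<Rightarrow> mat2"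
  assumes \<theta>: "\<And>n. \<theta> n \<in> hom G sanov" and \<rho>: "\<rho> \<in> hom H sanov"
    and \<theta>a: "\<And>n x. x \<in> carrier H \<Longrightarrow> \<theta> n (a x) = \<rho> x"
    and \<theta>b: "\<And>n x. x \<in> carrier H \<Longrightarrow> \<theta> n (b x)
      = U [^]\<^bsub>sanov\<^esub> n \<otimes>\<^bsub>sanov\<^esub> \<rho> x \<otimes>\<^bsub>sanov\<^esub> inv\<^bsub>sanov\<^esub> (U [^]\<^bsub>sanov\<^esub> n)"
    and \<rho>C: "\<And>x. x \<in> carrier H \<Longrightarrow> x \<notin> C \<Longrightarrow> \<nexists>k::int. \<rho> x = U [^]\<^bsub>sanov\<^esub> k"
    and inj: "\<And>x. x \<in> carrier H \<Longrightarrow> \<rho> x = \<one>\<^bsub>sanov\<^esub> \<Longrightarrow> x = \<one>\<^bsub>H\<^esub>"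
    and g: "has_normal_form H G a b C g" and one: "\<And>n. \<theta> n g = \<one>\<^bsub>sanov\<^esub>"
  shows "g = \<one>\<^bsub>G\<^esub>"
proof -
  obtain x where x: "x \<in> carrier H" "g = a x \<or> (\<exists>k\<in>alternating H G a b C. g = a x \<otimes>\<^bsub>G\<^esub> k)"
    using g unfolding has_normal_form_def by blast
  from x(2) show ?thesis
  proof
    assume "g = a x"
    then show ?thesis using inj[OF x(1)] \<theta>a[OF x(1)] one by simp
  next
    assume "\<exists>k\<in>alternating H G a b C. g = a x \<otimes>\<^bsub>G\<^esub> k"
    then obtain k where k: "k \<in> alternating H G a b C" "g = a x \<otimes>\<^bsub>G\<^esub> k" by blast
    obtain v m c where c: "c \<noteq> 0"
      and eig_coord: "(\<lambda>n. eig_inv ^ (2 * Suc m * n) * eig_coord (act (\<theta> n k) v)) \<longlonglongrightarrow> c"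
      using alternating_growth[OF \<theta> \<rho> \<theta>a \<theta>b \<rho>C k(1)] by blast
    have \<rho>x: "\<rho> x \<in> carrier sanov" using \<rho> x by (auto simp: hom_def)
    have "act (\<theta> n k) v = act (inv\<^bsub>sanov\<^esub> \<rho> x) v" for n
    proof -
      have "\<rho> x \<otimes>\<^bsub>sanov\<^esub> \<theta> n k = \<one>\<^bsub>sanov\<^esub>"
        using hom_mult[OF \<theta>, of "a x" k n] one[of n] k alternating_closed[OF k(1)] x \<theta>a by simp
      then have "act (\<rho> x) (act (\<theta> n k) v) = v" by (simp add: act_mult[symmetric])
      then show ?thesis using act_inv(2)[OF \<rho>x, of "act (\<theta> n k) v"] by simp
    qed
    then have lim: "(\<lambda>n. (eig_inv ^ (2 * Suc m)) ^ n * eig_coord (act (inv\<^bsub>sanov\<^esub> \<rho> x) v)) \<longlonglongrightarrow> c"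
      using eig_coord by (simp only: power_mult)
    have lt: "eig_inv ^ (2 * Suc m) < 1"
      using eig_inv_bounds by (subst power_less_one_iff) auto
    have "(\<lambda>n. (eig_inv ^ (2 * Suc m)) ^ n * eig_coord (act (inv\<^bsub>sanov\<^esub> \<rho> x) v)) \<longlonglongrightarrow> 0 * eig_coord (act (inv\<^bsub>sanov\<^esub> \<rho> x) v)"
      using eig_inv_bounds lt by (intro tendsto_intros LIMSEQ_realpow_zero) auto
    from LIMSEQ_unique[OF lim this] c show ?thesis by simp
  qed
qed

end

text \<open>The folding of the two factors combined with the \<open>n\<close>-th power of the Dehn
  twist along the separating curve. The index \<open>3 - i\<close> swaps the generators of the
  second factor, because the relation identifies \<open>[a_1,a_2]\<close> with
  \<open>[a_4,a_3]\<close>.\<close>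

definition theta_gens :: "nat \<Rightarrow> nat \<Rightarrow> mat2" where
  "theta_gens n i = (if i < 2 then sanov_gen i
     else U [^]\<^bsub>sanov\<^esub> n \<otimes>\<^bsub>sanov\<^esub> sanov_gen (3 - i) \<otimes>\<^bsub>sanov\<^esub> inv\<^bsub>sanov\<^esub> (U [^]\<^bsub>sanov\<^esub> n))"

lemma theta_gens_carrier [simp]: "theta_gens n i \<in> carrier sanov"
  by (simp add: theta_gens_def)

lemma theta_gens_relation:
  "comm sanov (theta_gens n 0) (theta_gens n 1) \<otimes>\<^bsub>sanov\<^esub> comm sanov (theta_gens n 2) (theta_gens n 3)
     = \<one>\<^bsub>sanov\<^esub>"
proof -
  let ?V = "U [^]\<^bsub>sanov\<^esub> n"
  have "comm sanov (theta_gens n 2) (theta_gens n 3)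
      = ?V \<otimes>\<^bsub>sanov\<^esub> inv\<^bsub>sanov\<^esub> (comm sanov (sanov_gen 0) (sanov_gen 1)) \<otimes>\<^bsub>sanov\<^esub> inv\<^bsub>sanov\<^esub> ?V"
    by (simp add: theta_gens_def sanov.comm_conj sanov.inv_commutator)
  also have "\<dots> = inv\<^bsub>sanov\<^esub> U"
  proof -
    have "U \<otimes>\<^bsub>sanov\<^esub> ?V = ?V \<otimes>\<^bsub>sanov\<^esub> U"
      using sanov.nat_pow_Suc2[OF U_carrier, of n] by simp
    then have "inv\<^bsub>sanov\<^esub> U \<otimes>\<^bsub>sanov\<^esub> inv\<^bsub>sanov\<^esub> ?V = inv\<^bsub>sanov\<^esub> ?V \<otimes>\<^bsub>sanov\<^esub> inv\<^bsub>sanov\<^esub> U"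
      using sanov.inv_mult_group[of U ?V] sanov.inv_mult_group[of ?V U] by simp
    then show ?thesis unfolding comm_sanov_gen by (simp add: sanov.m_assoc)
  qed
  finally show ?thesis
    unfolding theta_gens_def[of n 0] theta_gens_def[of n 1] using comm_sanov_gen by simp
qed

lemma theta_hom: "feval sanov (theta_gens n) \<in> hom (free_group 4) sanov"
  by (rule sanov.feval_hom) simp

lemma theta_surface_word: "feval sanov (theta_gens n) (surface_word 2) = \<one>\<^bsub>sanov\<^esub>"
  using hom_surface_word_2[OF group_sanov theta_hom, of n] theta_gens_relation[of n]
  by (simp only: sanov.feval_fgen theta_gens_carrier)

lemma quotient_hom:
  assumes "group F" "group K" "N \<lhd> F" "h \<in> hom F K" "\<And>x. x \<in> N \<Longrightarrow> h x = \<one>\<^bsub>K\<^esub>"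
  obtains e where "e \<in> hom (F Mod N) K" "\<And>x. x \<in> carrier F \<Longrightarrow> e (N #>\<^bsub>F\<^esub> x) = h x"
proof -
  interpret group_hom F K h
    using assms by (simp add: group_hom_def group_hom_axioms_def)
  have "N \<subseteq> kernel F K h"
    using assms(5) normal_imp_subgroup[OF assms(3)] subgroup.subset by (fastforce simp: kernel_def)
  then show thesis using FactGroup_universal_kernel[OF assms(3)] that by blast
qed

text \<open>Each generator of the genus two group is in the image of \<open>a\<close> or of
  \<open>b\<close>, so every element has a normal form, and growth detects it.\<close>

lemma theta_detect:
  assumes v: "v \<in> carrier (free_group 4)"
    and one: "\<And>n. feval sanov (theta_gens n) v = \<one>\<^bsub>sanov\<^esub>"
  shows "v \<in> normal_closure (free_group 4) {surface_word 2}"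
proof -
  let ?F4 = "free_group 4" and ?F2 = "free_group 2"
  define R where "R = normal_closure ?F4 {surface_word 2}"
  interpret F4: group ?F4 by (rule group_free_group)
  interpret F2: group ?F2 by (rule group_free_group)
  have sw: "surface_word 2 \<in> carrier ?F4" using surface_word_carrier[of 2] by simp
  have R: "R \<lhd> ?F4" unfolding R_def by (rule F4.normal_closure_normal) (use sw in simp)
  interpret R: normal R ?F4 by (rule R)
  let ?G = "?F4 Mod R"
  define \<pi> where "\<pi> x = R #>\<^bsub>?F4\<^esub> x" for x
  interpret G: group ?G by (rule R.factorgroup_is_group)
  have \<pi>hom: "\<pi> \<in> hom ?F4 ?G" unfolding \<pi>_def[abs_def] by (rule R.r_coset_hom_Mod)
  interpret \<pi>: group_hom ?F4 ?G \<pi>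
    using \<pi>hom by unfold_locales
  have gc: "fgen 0 \<in> carrier ?F4" "fgen 1 \<in> carrier ?F4" "fgen 2 \<in> carrier ?F4" "fgen 3 \<in> carrier ?F4"
    by (auto intro: fgen_carrier)
  have gc2: "fgen 0 \<in> carrier ?F2" "fgen 1 \<in> carrier ?F2"
    by (auto intro: fgen_carrier)
  define a where "a x = \<pi> (feval ?F4 fgen x)" for x
  \<comment> \<open>With the order of the generators reversed, the surface relation says precisely
    that \<open>a\<close> and \<open>b\<close> agree on the commutator \<open>u\<close> of the two
    generators.\<close>
  define b where "b x = \<pi> (feval ?F4 (\<lambda>i. fgen (3 - i)) x)" for x
  have a'hom: "feval ?F4 fgen \<in> hom ?F2 ?F4"
    by (rule F4.feval_hom) (auto intro: fgen_carrier)
  have b'hom: "feval ?F4 (\<lambda>i. fgen (3 - i)) \<in> hom ?F2 ?F4"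
    by (rule F4.feval_hom) (auto intro: fgen_carrier)
  have ahom: "a \<in> hom ?F2 ?G"
    using hom_compose[OF a'hom \<pi>hom] by (simp add: a_def[abs_def] comp_def)
  have bhom: "b \<in> hom ?F2 ?G"
    using hom_compose[OF b'hom \<pi>hom] by (simp add: b_def[abs_def] comp_def)
  interpret a: group_hom ?F2 ?G a using ahom by unfold_locales
  interpret b: group_hom ?F2 ?G b using bhom by unfold_locales
  have ag: "a (fgen 0) = \<pi> (fgen 0)" "a (fgen 1) = \<pi> (fgen 1)"
      "b (fgen 0) = \<pi> (fgen 3)" "b (fgen 1) = \<pi> (fgen 2)"
    using gc F4.feval_fgen[of fgen 0] F4.feval_fgen[of fgen 1]
      F4.feval_fgen[of "\<lambda>i. fgen (3 - i)" 0] F4.feval_fgen[of "\<lambda>i. fgen (3 - i)" 1]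
    by (simp_all add: a_def b_def)
  define u where "u = comm ?F2 (fgen 0) (fgen 1)"
  have u: "u \<in> carrier ?F2" using gc2 by (simp add: u_def)
  have "\<pi> (surface_word 2) = \<one>\<^bsub>?G\<^esub>"
    using F4.normal_closure_mem[of "surface_word 2" "{surface_word 2}"] sw
      R.rcos_eq_self_iff[OF sw] by (simp add: \<pi>_def R_def)
  then have "comm ?G (\<pi> (fgen 0)) (\<pi> (fgen 1)) \<otimes>\<^bsub>?G\<^esub> comm ?G (\<pi> (fgen 2)) (\<pi> (fgen 3)) = \<one>\<^bsub>?G\<^esub>"
    using hom_surface_word_2[OF G.is_group \<pi>hom] by simp
  then have "comm ?G (\<pi> (fgen 0)) (\<pi> (fgen 1)) = inv\<^bsub>?G\<^esub> (comm ?G (\<pi> (fgen 2)) (\<pi> (fgen 3)))"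
    using gc G.inv_equality G.inv_inv by (metis G.comm_closed \<pi>.hom_closed)
  also have "\<dots> = comm ?G (\<pi> (fgen 3)) (\<pi> (fgen 2))"
    using gc by (intro G.inv_commutator) simp_all
  finally have au: "a u = b u"
    using hom_comm[OF F2.is_group G.is_group ahom gc2] hom_comm[OF F2.is_group G.is_group bhom gc2]
    by (simp only: u_def ag)
  have \<rho>hom: "sanov_rep \<in> hom ?F2 sanov" by (rule sanov.feval_hom) simp
  interpret \<rho>: group_hom ?F2 sanov sanov_rep using \<rho>hom by unfold_locales
  have \<rho>inj: "x = \<one>\<^bsub>?F2\<^esub>" if "x \<in> carrier ?F2" "sanov_rep x = \<one>\<^bsub>sanov\<^esub>" for x
    using sanov_rep_faithful[OF that] by (simp add: one_free_group)
  have \<rho>u: "sanov_rep u = U"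
    using hom_comm[OF F2.is_group group_sanov \<rho>hom gc2] comm_sanov_gen
    by (simp only: u_def sanov.feval_fgen sanov_gen_carrier)
  \<comment> \<open>Described by matrices, so that elements outside \<open>C\<close> are not mapped
    to powers of \<open>U\<close>, by definition. Faithfulness of \<open>sanov_rep\<close> shows
    that \<open>C\<close> consists of powers of \<open>u\<close>, where \<open>a\<close> and
    \<open>b\<close> agree.\<close>
  define C where "C = {x \<in> carrier ?F2. \<exists>k::int. sanov_rep x = U [^]\<^bsub>sanov\<^esub> k}"
  have agree: "a c = b c" if c: "c \<in> C" for c
  proof -
    obtain k :: int where k: "c \<in> carrier ?F2" "sanov_rep c = U [^]\<^bsub>sanov\<^esub> k"
      using c unfolding C_def by blast
    have "sanov_rep (c \<otimes>\<^bsub>?F2\<^esub> inv\<^bsub>?F2\<^esub> (u [^]\<^bsub>?F2\<^esub> k)) = \<one>\<^bsub>sanov\<^esub>"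
      using k u by (simp add: \<rho>.hom_int_pow \<rho>u)
    then have "c \<otimes>\<^bsub>?F2\<^esub> inv\<^bsub>?F2\<^esub> (u [^]\<^bsub>?F2\<^esub> k) = \<one>\<^bsub>?F2\<^esub>"
      using k u by (intro \<rho>inj) simp_all
    then have "c = u [^]\<^bsub>?F2\<^esub> k"
      by (rule F2.eq_of_mult_inv_eq_one[rotated 2]) (use k(1) u in simp_all)
    then show ?thesis using u au by (simp add: a.hom_int_pow b.hom_int_pow)
  qed
  have Csub: "C \<subseteq> carrier ?F2" by (auto simp: C_def)
  have "\<exists>e. e \<in> hom ?G sanov \<and> (\<forall>x\<in>carrier ?F4. e (\<pi> x) = feval sanov (theta_gens n) x)" for n
  proof -
    have "feval sanov (theta_gens n) x = \<one>\<^bsub>sanov\<^esub>" if "x \<in> R" for x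
      using normal_closure_kernel[OF F4.is_group group_sanov theta_hom, of "{surface_word 2}" n x]
        sw theta_surface_word that by (simp add: R_def)
    from quotient_hom[OF F4.is_group group_sanov R theta_hom[of n] this]
    show ?thesis unfolding \<pi>_def by metis
  qed
  then obtain \<theta> where \<theta>: "\<And>n. \<theta> n \<in> hom ?G sanov"
    and \<theta>\<pi>: "\<And>n x. x \<in> carrier ?F4 \<Longrightarrow> \<theta> n (\<pi> x) = feval sanov (theta_gens n) x"
    by metis
  have \<theta>a: "\<theta> n (a x) = sanov_rep x" if x: "x \<in> carrier ?F2" for n x
  proof (rule sanov.hom_free_group_eqI[OF _ \<rho>hom _ x])
    show "(\<lambda>x. \<theta> n (a x)) \<in> hom ?F2 sanov"
      using hom_compose[OF ahom \<theta>[of n]] by (simp add: comp_def)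
    show "\<theta> n (a (fgen i)) = sanov_rep (fgen i)" if "i < 2" for i
      using that gc by (auto simp: less_2_cases_iff ag[simplified] \<theta>\<pi> sanov.feval_fgen theta_gens_def)
  qed
  have \<theta>b: "\<theta> n (b x) = U [^]\<^bsub>sanov\<^esub> n \<otimes>\<^bsub>sanov\<^esub> sanov_rep x \<otimes>\<^bsub>sanov\<^esub> inv\<^bsub>sanov\<^esub> (U [^]\<^bsub>sanov\<^esub> n)"
    if x: "x \<in> carrier ?F2" for n x
  proof (rule sanov.hom_free_group_eqI[OF _ _ _ x])
    show "(\<lambda>x. \<theta> n (b x)) \<in> hom ?F2 sanov"
      using hom_compose[OF bhom \<theta>[of n]] by (simp add: comp_def)
    show "(\<lambda>x. U [^]\<^bsub>sanov\<^esub> n \<otimes>\<^bsub>sanov\<^esub> sanov_rep x \<otimes>\<^bsub>sanov\<^esub> inv\<^bsub>sanov\<^esub> (U [^]\<^bsub>sanov\<^esub> n)) \<in> hom ?F2 sanov"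
      by (rule homI) (simp_all add: sanov.m_assoc)
    show "\<theta> n (b (fgen i))
        = U [^]\<^bsub>sanov\<^esub> n \<otimes>\<^bsub>sanov\<^esub> sanov_rep (fgen i) \<otimes>\<^bsub>sanov\<^esub> inv\<^bsub>sanov\<^esub> (U [^]\<^bsub>sanov\<^esub> n)" if "i < 2" for i
      using that gc by (auto simp: less_2_cases_iff ag[simplified] \<theta>\<pi> sanov.feval_fgen theta_gens_def)
  qed
  have nf: "has_normal_form ?F2 ?G a b C (\<pi> v)"
    using v
  proof (induction rule: free_group_induct)
    case one
    have "\<pi> [] = a \<one>\<^bsub>?F2\<^esub>"
      using \<pi>.hom_one a.hom_one by (simp only: one_free_group)
    then show ?case unfolding has_normal_form_def using F2.one_closed by blast
  next
    case (gen i w)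
    have "i = 0 \<or> i = 1 \<or> i = 2 \<or> i = 3" using gen(1) by auto
    then obtain z where z: "z \<in> carrier ?F2" "\<pi> (fgen i) = a z \<or> \<pi> (fgen i) = b z"
      using ag gc2 by metis
    have "\<pi> (fgen i \<otimes>\<^bsub>?F4\<^esub> w) = \<pi> (fgen i) \<otimes>\<^bsub>?G\<^esub> \<pi> w"
      using gen by (intro \<pi>.hom_mult fgen_carrier)
    then show ?case
      using z has_normal_form_left_a[OF F2.is_group G.is_group ahom bhom Csub agree gen(3) z(1)]
        has_normal_form_left_b[OF F2.is_group G.is_group ahom bhom Csub agree gen(3) z(1)] by auto
  next
    case (inv i w)
    have "i = 0 \<or> i = 1 \<or> i = 2 \<or> i = 3" using inv(1) by auto
    then obtain z where z: "z \<in> carrier ?F2" "\<pi> (fgen i) = a z \<or> \<pi> (fgen i) = b z"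
      using ag gc2 by metis
    have z': "inv\<^bsub>?F2\<^esub> z \<in> carrier ?F2" using z by simp
    have "\<pi> (inv\<^bsub>?F4\<^esub> (fgen i) \<otimes>\<^bsub>?F4\<^esub> w) = inv\<^bsub>?G\<^esub> \<pi> (fgen i) \<otimes>\<^bsub>?G\<^esub> \<pi> w"
      using inv fgen_carrier[OF inv(1)] by simp
    then show ?case
      using z has_normal_form_left_a[OF F2.is_group G.is_group ahom bhom Csub agree inv(3) z']
        has_normal_form_left_b[OF F2.is_group G.is_group ahom bhom Csub agree inv(3) z'] by auto
  qed
  have "\<pi> v = \<one>\<^bsub>?G\<^esub>"
  proof (rule has_normal_form_detect[OF F2.is_group G.is_group ahom bhom Csub agree \<theta> \<rho>hom \<theta>a \<theta>b _ \<rho>inj nf])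
    show "\<nexists>k::int. sanov_rep x = U [^]\<^bsub>sanov\<^esub> k" if "x \<in> carrier ?F2" "x \<notin> C" for x
      using that by (simp add: C_def)
    show "\<theta> n (\<pi> v) = \<one>\<^bsub>sanov\<^esub>" for n using \<theta>\<pi>[OF v] one by simp
  qed
  then show ?thesis using R.rcos_eq_self_iff[OF v] by (simp add: \<pi>_def R_def)
qed

section \<open>Surface groups are residually nilpotent\<close>

definition congruence_sanov :: "int \<Rightarrow> mat2 set" where
  "congruence_sanov D = {(p, q, r, s). (p, q, r, s) \<in> carrier sanov
     \<and> D dvd p - 1 \<and> D dvd q \<and> D dvd r \<and> D dvd s - 1}"

lemma congruence_sanov_iff:
  "(p, q, r, s) \<in> congruence_sanov D \<longleftrightarrow>
     (p, q, r, s) \<in> carrier sanov \<and> D dvd p - 1 \<and> D dvd q \<and> D dvd r \<and> D dvd s - 1"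
  by (simp add: congruence_sanov_def)

lemma congruence_sanov_mult_inv:
  assumes m: "(p, q, r, s) \<in> carrier sanov" "(p', q', r', s') \<in> carrier sanov"
    and d: "D dvd p - p'" "D dvd q - q'" "D dvd r - r'" "D dvd s - s'"
  shows "(p, q, r, s) \<otimes>\<^bsub>sanov\<^esub> inv\<^bsub>sanov\<^esub> (p', q', r', s') \<in> congruence_sanov D"
proof -
  have c: "(p, q, r, s) \<otimes>\<^bsub>sanov\<^esub> inv\<^bsub>sanov\<^esub> (p', q', r', s') \<in> carrier sanov"
    using m by (intro sanov.m_closed sanov.inv_closed)
  have det: "p' * s' - q' * r' = 1" using m(2) by (simp add: carrier_sanov)
  have "p * s' - q * r' - 1 = (p - p') * s' - (q - q') * r'" using det by (simp add: algebra_simps)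
  moreover have "q * p' - p * q' = (q - q') * p' - (p - p') * q'" by (simp add: algebra_simps)
  moreover have "r * s' - s * r' = (r - r') * s' - (s - s') * r'" by (simp add: algebra_simps)
  moreover have "s * p' - r * q' - 1 = (s - s') * p' - (r - r') * q'" using det by (simp add: algebra_simps)
  ultimately have "D dvd p * s' - q * r' - 1" "D dvd q * p' - p * q'"
      "D dvd r * s' - s * r'" "D dvd s * p' - r * q' - 1"
    using d by simp_all
  then show ?thesis
    using c by (simp add: congruence_sanov_iff inv_sanov[OF m(2)] mult_sanov algebra_simps)
qed

lemma congruence_sanov_subgroup: "subgroup (congruence_sanov D) sanov"
proof (rule sanov.subgroupI)
  show "congruence_sanov D \<subseteq> carrier sanov" by (auto simp: congruence_sanov_def)
  have "\<one>\<^bsub>sanov\<^esub> \<in> congruence_sanov D" by (simp add: one_sanov congruence_sanov_iff carrier_sanov)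
  then show "congruence_sanov D \<noteq> {}" by blast
  have diff: "x \<otimes>\<^bsub>sanov\<^esub> inv\<^bsub>sanov\<^esub> y \<in> congruence_sanov D" if "x \<in> congruence_sanov D" "y \<in> congruence_sanov D" for x y
  proof -
    obtain p q r s p' q' r' s' where xy: "x = (p, q, r, s)" "y = (p', q', r', s')"
      by (cases x; cases y)
    have "D dvd (p - 1) - (p' - 1)" "D dvd q - q'" "D dvd r - r'" "D dvd (s - 1) - (s' - 1)"
      using that unfolding xy congruence_sanov_iff by (blast intro: dvd_diff)+
    then show ?thesis
      using that unfolding xy by (intro congruence_sanov_mult_inv) (simp_all add: congruence_sanov_iff)
  qed
  fix x y assume x: "x \<in> congruence_sanov D" and y: "y \<in> congruence_sanov D"
  have xc: "x \<in> carrier sanov" "y \<in> carrier sanov" using x y by (auto simp: congruence_sanov_def)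
  have inv: "inv\<^bsub>sanov\<^esub> x \<in> congruence_sanov D" if "x \<in> congruence_sanov D" for x
  proof -
    have "x \<in> carrier sanov" using that by (auto simp: congruence_sanov_def)
    then show ?thesis using diff[OF \<open>\<one>\<^bsub>sanov\<^esub> \<in> congruence_sanov D\<close> that] by simp
  qed
  show "inv\<^bsub>sanov\<^esub> x \<in> congruence_sanov D" by (rule inv[OF x])
  show "x \<otimes>\<^bsub>sanov\<^esub> y \<in> congruence_sanov D" using diff[OF x inv[OF y]] xc by simp
qed

text \<open>\<open>xy - yx = (x - 1)(y - 1) - (y - 1)(x - 1)\<close>, where \<open>x - 1\<close> is
  divisible by 2 and \<open>y - 1\<close> by \<open>D\<close>. Hence \<open>xy\<close> and
  \<open>yx\<close> agree modulo \<open>2 * D\<close>, and the commutator is their quotient.\<close>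

lemma comm_congruence_sanov:
  assumes x: "x \<in> carrier sanov" and y: "y \<in> congruence_sanov D"
  shows "comm sanov x y \<in> congruence_sanov (2 * D)"
proof -
  obtain p q r s p' q' r' s' where xy: "x = (p, q, r, s)" "y = (p', q', r', s')"
    by (cases x; cases y)
  have yc: "y \<in> carrier sanov" using y by (auto simp: congruence_sanov_def)
  have "even (p - s)" using x xy by (simp add: carrier_sanov) presburger
  have e: "even q" "even r" using x xy by (auto simp: carrier_sanov)
  have d: "D dvd q'" "D dvd r'" "D dvd s' - p'"
    using y xy dvd_diff[of D "s' - 1" "p' - 1"] by (auto simp: congruence_sanov_iff)
  have m: "2 * D dvd b * a" if "even b" "D dvd a" for a b using that by (rule mult_dvd_mono)
  have "(x \<otimes>\<^bsub>sanov\<^esub> y) \<otimes>\<^bsub>sanov\<^esub> inv\<^bsub>sanov\<^esub> (y \<otimes>\<^bsub>sanov\<^esub> x) \<in> congruence_sanov (2 * D)"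
    unfolding xy mult_sanov
  proof (rule congruence_sanov_mult_inv)
    show "(p * p' + q * r', p * q' + q * s', r * p' + s * r', r * q' + s * s') \<in> carrier sanov"
      using sanov.m_closed[OF x yc] by (simp add: xy mult_sanov)
    show "(p' * p + q' * r, p' * q + q' * s, r' * p + s' * r, r' * q + s' * s) \<in> carrier sanov"
      using sanov.m_closed[OF yc x] by (simp add: xy mult_sanov)
    have "2 * D dvd q * r' - r * q'" using m[OF e(1) d(2)] m[OF e(2) d(1)] by (rule dvd_diff)
    then show "2 * D dvd (p * p' + q * r') - (p' * p + q' * r)" by (simp add: algebra_simps)
    have "2 * D dvd r * q' - q * r'" using m[OF e(2) d(1)] m[OF e(1) d(2)] by (rule dvd_diff)
    then show "2 * D dvd (r * q' + s * s') - (r' * q + s' * s)" by (simp add: algebra_simps)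
    have "2 * D dvd (p - s) * q' + q * (s' - p')"
      using m[OF \<open>even (p - s)\<close> d(1)] m[OF e(1) d(3)] by (rule dvd_add)
    then show "2 * D dvd (p * q' + q * s') - (p' * q + q' * s)" by (simp add: algebra_simps)
    have "2 * D dvd - ((p - s) * r' + r * (s' - p'))"
      using m[OF \<open>even (p - s)\<close> d(2)] m[OF e(2) d(3)] by (simp del: minus_add_distrib)
    then show "2 * D dvd (r * p' + s * r') - (r' * p + s' * r)" by (simp add: algebra_simps)
  qed
  also have "(x \<otimes>\<^bsub>sanov\<^esub> y) \<otimes>\<^bsub>sanov\<^esub> inv\<^bsub>sanov\<^esub> (y \<otimes>\<^bsub>sanov\<^esub> x) = comm sanov x y"
    using x yc by (simp add: comm_def sanov.inv_mult_group sanov.m_assoc)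
  finally show ?thesis .
qed

lemma congruence_sanov_2: "congruence_sanov 2 = carrier sanov"
proof -
  have "even (p - 1)" if "p mod 4 = 1" for p :: int using that by presburger
  then show ?thesis by (auto simp: congruence_sanov_def carrier_sanov)
qed

lemma lcs_image_congruence_sanov:
  assumes "group G" "e \<in> hom G sanov" "k \<ge> 1" "x \<in> lcs G k"
  shows "e x \<in> congruence_sanov (2 ^ k)"
proof -
  interpret group_hom G sanov e
    using assms by (simp add: group_hom_def group_hom_axioms_def)
  define M where "M k = {x \<in> carrier G. e x \<in> congruence_sanov (2 ^ k)}" for k :: nat
  have "lcs G k \<subseteq> M k"
  proof (rule G.lcs_le_filtration[OF _ _ _ \<open>k \<ge> 1\<close>])
    fix k
    interpret C: subgroup "congruence_sanov (2 ^ k)" sanov by (rule congruence_sanov_subgroup)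
    show "subgroup (M k) G"
    proof (rule G.subgroupI)
      show "M k \<noteq> {}" using G.one_closed C.one_closed by (force simp: M_def)
    qed (auto simp: M_def)
    show "carrier G \<subseteq> M 1" by (auto simp: M_def congruence_sanov_2)
    fix x y assume "x \<in> carrier G" "y \<in> M k"
    then show "comm G x y \<in> M (Suc k)"
      using comm_congruence_sanov[of "e x" "e y" "2 ^ k"] hom_comm[OF G.is_group group_sanov homh]
      by (simp add: M_def)
  qed
  then show ?thesis using assms(4) by (auto simp: M_def)
qed

lemma int_eq_0_of_all_pow2_dvd:
  fixes z :: int
  assumes "\<And>k. k \<ge> 1 \<Longrightarrow> 2 ^ k dvd z"
  shows "z = 0"
proof (rule ccontr)
  assume "z \<noteq> 0"
  let ?k = "Suc (nat \<bar>z\<bar>)"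
  have "nat \<bar>z\<bar> < 2 ^ nat \<bar>z\<bar>" by (rule less_exp)
  then have "int (nat \<bar>z\<bar>) < int (2 ^ nat \<bar>z\<bar>)" by (simp only: of_nat_less_iff)
  then have "\<bar>z\<bar> < 2 ^ ?k" by simp
  moreover have "2 ^ ?k dvd \<bar>z\<bar>" using assms[of ?k] by simp
  ultimately show False using \<open>z \<noteq> 0\<close> zdvd_imp_le[of "2 ^ ?k" "\<bar>z\<bar>"] by simp
qed

lemma congruence_sanov_inter:
  assumes "\<And>k. k \<ge> 1 \<Longrightarrow> m \<in> congruence_sanov (2 ^ k)"
  shows "m = \<one>\<^bsub>sanov\<^esub>"
proof -
  obtain p q r s where m: "m = (p, q, r, s)" by (cases m)
  have "2 ^ k dvd p - 1" "2 ^ k dvd q" "2 ^ k dvd r" "2 ^ k dvd s - 1" if "k \<ge> 1" for k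
    using assms[OF that] unfolding m congruence_sanov_iff by blast+
  then have "p - 1 = 0" "q = 0" "r = 0" "s - 1 = 0"
    by (blast intro: int_eq_0_of_all_pow2_dvd)+
  then show ?thesis by (simp add: m one_sanov)
qed

text \<open>The twisted representations, pulled back along the cover, send the coset of
  \<open>v\<close> into all congruence subgroups modulo powers of 2, hence to the identity. So
  \<open>cov v\<close> is trivial in the genus two group.\<close>

lemma surface_group_residually_nilpotent:
  fixes g :: nat
  defines "F \<equiv> free_group (2 * g)"
    and "R \<equiv> normal_closure (free_group (2 * g)) {surface_word g}"
  assumes g: "g \<ge> 2" and v: "v \<in> carrier F"
    and lcs: "\<And>k. k \<ge> 1 \<Longrightarrow> R #>\<^bsub>F\<^esub> v \<in> lcs (F Mod R) k"
  shows "v \<in> R"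
proof -
  \<comment> \<open>The degree of the cover: degree \<open>n\<close> over genus two gives genus
    \<open>n + 1\<close>.\<close>
  define n where "n = g - 1"
  have gn: "g = Suc n" "n > 0" using g by (auto simp: n_def)
  interpret F: group F unfolding F_def by (rule group_free_group)
  let ?F4 = "free_group 4"
  interpret F4: group ?F4 by (rule group_free_group)
  have sw: "surface_word g \<in> carrier F" unfolding F_def by (rule surface_word_carrier)
  have Rn: "R \<lhd> F" unfolding R_def F_def[symmetric]
    by (rule F.normal_closure_normal) (use sw in simp)
  interpret R: normal R F by (rule Rn)
  let ?G = "F Mod R"
  interpret G: group ?G by (rule R.factorgroup_is_group)
  interpret \<pi>: group_hom F ?G "\<lambda>x. R #>\<^bsub>F\<^esub> x"
    using R.r_coset_hom_Mod by unfold_locales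
  have gens: "fgen i \<in> carrier F" if "i < 2 * g" for i unfolding F_def using that by (rule fgen_carrier)
  have gc: "fgen 0 \<in> carrier ?F4" "fgen 1 \<in> carrier ?F4" "fgen 2 \<in> carrier ?F4" "fgen 3 \<in> carrier ?F4"
    by (auto intro: fgen_carrier)
  let ?cg = "cover_gens ?F4 n (fgen 0) (fgen 1) (fgen 2) (fgen 3)"
  define cov where "cov = feval ?F4 ?cg"
  have covhom: "cov \<in> hom F ?F4"
    unfolding cov_def F_def using gc by (intro F4.feval_hom F4.cover_gens_closed)
  interpret cov: group_hom F ?F4 cov using covhom by unfold_locales
  have "feval sanov (theta_gens m) (cov v) = \<one>\<^bsub>sanov\<^esub>" for m
  proof -
    let ?\<theta> = "feval sanov (theta_gens m)"
    interpret \<theta>: group_hom ?F4 sanov ?\<theta> using theta_hom by unfold_locales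
    have hhom: "(\<lambda>x. ?\<theta> (cov x)) \<in> hom F sanov"
      using hom_compose[OF covhom theta_hom] by (simp add: comp_def)
    have "?\<theta> (cov (fgen i)) = cover_gens sanov n (theta_gens m 0) (theta_gens m 1) (theta_gens m 2) (theta_gens m 3) i" for i
    proof -
      have "cov (fgen i) = ?cg i"
        unfolding cov_def using gc by (intro F4.feval_fgen F4.cover_gens_closed)
      then show ?thesis
        using gc by (simp add: cover_gens_def \<theta>.hom_nat_pow sanov.feval_fgen)
    qed
    then have "?\<theta> (cov (surface_word g)) = \<one>\<^bsub>sanov\<^esub>"
      using hom_surface_word[OF group_sanov hhom[unfolded F_def]]
        sanov.comm_prod_cover_gens[OF _ _ _ _ theta_gens_relation[of m], of n]
      by (simp add: gn(1))
    then have "?\<theta> (cov x) = \<one>\<^bsub>sanov\<^esub>" if "x \<in> R" for x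
      using normal_closure_kernel[OF F.is_group group_sanov hhom, of "{surface_word g}" x] sw that
      by (simp add: R_def F_def)
    from quotient_hom[OF F.is_group group_sanov Rn hhom this] obtain e
      where e: "e \<in> hom ?G sanov" "\<And>x. x \<in> carrier F \<Longrightarrow> e (R #>\<^bsub>F\<^esub> x) = ?\<theta> (cov x)" by blast
    show ?thesis
    proof (rule congruence_sanov_inter)
      fix k :: nat assume "k \<ge> 1"
      then show "?\<theta> (cov v) \<in> congruence_sanov (2 ^ k)"
        using lcs_image_congruence_sanov[OF G.is_group e(1) _ lcs] e(2)[OF v] by simp
    qed
  qed
  then have "cov v \<in> normal_closure ?F4 {surface_word 2}"
    by (rule theta_detect[OF cov.hom_closed[OF v]])
  moreover have "comm_prod ?G (\<lambda>i. R #>\<^bsub>F\<^esub> fgen i) [0..<g] = \<one>\<^bsub>?G\<^esub>"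
  proof -
    have "R #>\<^bsub>F\<^esub> surface_word g = \<one>\<^bsub>?G\<^esub>"
      using F.normal_closure_mem[of "surface_word g" "{surface_word g}"] sw R.rcos_eq_self_iff[OF sw]
      by (simp add: R_def F_def)
    then show ?thesis
      using hom_surface_word[of ?G "\<lambda>x. R #>\<^bsub>F\<^esub> x" g] \<pi>.homh G.is_group by (simp add: F_def[symmetric])
  qed
  \<comment> \<open>The target of the detection is the surface group itself with its standard
    generators, so that the evaluation map is the projection.\<close>
  ultimately have 1: "feval ?G (\<lambda>i. R #>\<^bsub>F\<^esub> fgen i) v = \<one>\<^bsub>?G\<^esub>"
    using gens v unfolding cov_def gn(1)
    by (intro cover_gens_detect[OF G.is_group gn(2)]) (simp_all add: F_def gn(1) carrier_FactGroup del: upt_Suc)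
  have "feval ?G (\<lambda>i. R #>\<^bsub>F\<^esub> fgen i) v = R #>\<^bsub>F\<^esub> v"
  proof (rule G.hom_free_group_eqI)
    show "feval ?G (\<lambda>i. R #>\<^bsub>F\<^esub> fgen i) \<in> hom (free_group (2 * g)) ?G"
      using gens by (intro G.feval_hom) simp
    show "(\<lambda>x. R #>\<^bsub>F\<^esub> x) \<in> hom (free_group (2 * g)) ?G"
      using \<pi>.homh unfolding F_def .
    show "feval ?G (\<lambda>i. R #>\<^bsub>F\<^esub> fgen i) (fgen i) = R #>\<^bsub>F\<^esub> fgen i" if "i < 2 * g" for i
      using gens[OF that] by (intro G.feval_fgen) simp
    show "v \<in> carrier (free_group (2 * g))" using v by (simp add: F_def)
  qed
  then show ?thesis using 1 R.rcos_eq_self_iff[OF v] by simp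
qed

theorem theorem4:
  fixes g :: nat and N :: "fword set"
  defines "F \<equiv> free_group (2 * g)"
      and "R \<equiv> normal_closure (free_group (2 * g)) {surface_word g}"
  assumes "g \<ge> 2"
      and "N \<lhd> F"
      and "\<forall>k\<ge>1. (F Mod N) Mod (lcs (F Mod N) k) \<cong> (F Mod R) Mod (lcs (F Mod R) k)"
  shows "((\<exists>\<phi>\<in>iso F F. R \<subseteq> \<phi> ` N) \<longrightarrow> F Mod N \<cong> F Mod R)
       \<and> ((\<exists>\<phi>\<in>iso F F. \<phi> ` N \<subset> R) \<longrightarrow> \<not> residually_nilpotent (F Mod N))"
proof -
  interpret F: group F unfolding F_def by (rule group_free_group)
  have sw: "surface_word g \<in> carrier F" unfolding F_def by (rule surface_word_carrier)
  have Rn: "R \<lhd> F" unfolding R_def F_def[symmetric]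
    by (rule F.normal_closure_normal) (use sw in simp)
  interpret R: normal R F by (rule Rn)
  interpret N: normal N F by fact
  let ?G = "F Mod N" and ?\<Gamma> = "F Mod R"
  interpret G: group ?G by (rule N.factorgroup_is_group)
  interpret \<Gamma>: group ?\<Gamma> by (rule R.factorgroup_is_group)
  have fg: "finite (fgen ` {..<2 * g})" "fgen ` {..<2 * g} \<subseteq> carrier F"
      "generate F (fgen ` {..<2 * g}) = carrier F"
    unfolding F_def by (auto intro: fgen_carrier simp: generate_fgen)
  have iso: "?G Mod lcs ?G k \<cong> ?\<Gamma> Mod lcs ?\<Gamma> k" if "k \<ge> 1" for k
    using assms(5) that by blast
  have iso': "?\<Gamma> Mod lcs ?\<Gamma> k \<cong> ?G Mod lcs ?G k" if "k \<ge> 1" for k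
    by (rule group.iso_sym[OF normal.factorgroup_is_group[OF G.lcs_normal] iso[OF that]])
  define p where "p x = N #>\<^bsub>F\<^esub> x" for x
  define q where "q x = R #>\<^bsub>F\<^esub> x" for x
  have p: "p \<in> hom F ?G" "p ` carrier F = carrier ?G"
    unfolding p_def[abs_def] using N.r_coset_hom_Mod by (simp_all add: carrier_FactGroup)
  have q: "q \<in> hom F ?\<Gamma>" "q ` carrier F = carrier ?\<Gamma>"
    unfolding q_def[abs_def] using R.r_coset_hom_Mod by (simp_all add: carrier_FactGroup)
  have p1: "p x = \<one>\<^bsub>?G\<^esub> \<longleftrightarrow> x \<in> N" if "x \<in> carrier F" for x
    using N.rcos_eq_self_iff[OF that] by (simp add: p_def)
  have q1: "q x = \<one>\<^bsub>?\<Gamma>\<^esub> \<longleftrightarrow> x \<in> R" if "x \<in> carrier F" for x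
    using R.rcos_eq_self_iff[OF that] by (simp add: q_def)
  show ?thesis
  proof (intro conjI impI)
    assume "\<exists>\<phi>\<in>iso F F. R \<subseteq> \<phi> ` N"
    then obtain \<phi> where \<phi>: "\<phi> \<in> hom F F" "bij_betw \<phi> (carrier F) (carrier F)" and sub: "R \<subseteq> \<phi> ` N"
      by (auto simp: iso_def)
    define \<psi> where "\<psi> = inv_into (carrier F) \<phi>"
    have \<psi>: "\<psi> \<in> hom F F" "bij_betw \<psi> (carrier F) (carrier F)"
      using F.iso_set_sym[of \<phi> F] \<phi> by (auto simp: iso_def \<psi>_def)
    have \<psi>\<phi>: "\<psi> (\<phi> x) = x" if "x \<in> carrier F" for x
      using \<phi>(2) that unfolding \<psi>_def bij_betw_def by simp
    have h: "(\<lambda>x. p (\<psi> x)) \<in> hom F ?G"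
      using hom_compose[OF \<psi>(1) p(1)] by (simp add: comp_def)
    have hs: "(\<lambda>x. p (\<psi> x)) ` carrier F = carrier ?G"
      using p(2) \<psi>(2) by (simp add: bij_betw_def image_image[symmetric])
    have ker: "p (\<psi> x) = \<one>\<^bsub>?G\<^esub>" if "x \<in> carrier F" "q x = \<one>\<^bsub>?\<Gamma>\<^esub>" for x
    proof -
      have "x \<in> \<phi> ` N" using that q1 sub by blast
      then obtain y where "y \<in> N" "x = \<phi> y" by blast
      then show ?thesis using \<psi>\<phi> p1 by simp
    qed
    have "\<phi> y \<in> R" if y: "y \<in> N" for y
    proof (rule surface_group_residually_nilpotent[OF \<open>g \<ge> 2\<close>, folded F_def R_def])
      have yc: "y \<in> carrier F" using y by simp
      show c: "\<phi> y \<in> carrier F" using \<phi>(2) yc by (auto simp: bij_betw_def)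
      fix k :: nat assume k: "k \<ge> 1"
      \<comment> \<open>This element is even trivial. The kernel of the epimorphism
        \<open>p \<circ> \<psi>\<close> contains \<open>R\<close>, so the transfer places
        \<open>q (\<phi> y)\<close> in every term of the lower central series of the surface group,
        where residual nilpotence applies.\<close>
      have "p (\<psi> (\<phi> y)) \<in> lcs ?G k"
        using p1[OF yc] y \<psi>\<phi>[OF yc] subgroup.one_closed[OF G.lcs_subgroup[of k]] by simp
      then have "q (\<phi> y) \<in> lcs ?\<Gamma> k"
        using lcs_of_isomorphic_lcs_quotients[OF F.is_group \<Gamma>.is_group G.is_group fg q h hs ker iso'[OF k] c]
        by blast
      then show "R #>\<^bsub>F\<^esub> \<phi> y \<in> lcs ?\<Gamma> k" by (simp add: q_def)
    qed
    then have eq: "\<phi> ` N = R" using sub by blast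
    have f: "(\<lambda>x. q (\<phi> x)) \<in> hom F ?\<Gamma>"
      using hom_compose[OF \<phi>(1) q(1)] by (simp add: comp_def)
    interpret f: group_hom F ?\<Gamma> "\<lambda>x. q (\<phi> x)" using f by unfold_locales
    have "kernel F ?\<Gamma> (\<lambda>x. q (\<phi> x)) = N"
    proof -
      have "q (\<phi> x) = \<one>\<^bsub>?\<Gamma>\<^esub> \<longleftrightarrow> x \<in> N" if x: "x \<in> carrier F" for x
      proof -
        have "\<phi> x \<in> carrier F" using \<phi>(2) x by (auto simp: bij_betw_def)
        then have "q (\<phi> x) = \<one>\<^bsub>?\<Gamma>\<^esub> \<longleftrightarrow> \<phi> x \<in> \<phi> ` N" using q1 eq by simp
        also have "\<dots> \<longleftrightarrow> x \<in> N"
          by (rule inj_on_image_mem_iff[OF bij_betw_imp_inj_on[OF \<phi>(2)] x N.subset])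
        finally show ?thesis .
      qed
      then show ?thesis using N.subset by (auto simp: kernel_def simp del: one_FactGroup)
    qed
    moreover have "(\<lambda>x. q (\<phi> x)) ` carrier F = carrier ?\<Gamma>"
      using q(2) \<phi>(2) by (simp add: bij_betw_def image_image[symmetric])
    ultimately show "?G \<cong> ?\<Gamma>" using f.FactGroup_iso by simp
  next
    assume "\<exists>\<phi>\<in>iso F F. \<phi> ` N \<subset> R"
    then obtain \<phi> where \<phi>: "\<phi> \<in> hom F F" "bij_betw \<phi> (carrier F) (carrier F)"
      and sub: "\<phi> ` N \<subseteq> R" and ne: "\<phi> ` N \<noteq> R"
      by (auto simp: iso_def)
    have h: "(\<lambda>x. q (\<phi> x)) \<in> hom F ?\<Gamma>"
      using hom_compose[OF \<phi>(1) q(1)] by (simp add: comp_def)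
    have hs: "(\<lambda>x. q (\<phi> x)) ` carrier F = carrier ?\<Gamma>"
      using q(2) \<phi>(2) by (simp add: bij_betw_def image_image[symmetric])
    have \<phi>c: "\<phi> x \<in> carrier F" if "x \<in> carrier F" for x using \<phi>(2) that by (auto simp: bij_betw_def)
    have ker: "q (\<phi> x) = \<one>\<^bsub>?\<Gamma>\<^esub>" if "x \<in> carrier F" "p x = \<one>\<^bsub>?G\<^esub>" for x
      using that p1 q1[OF \<phi>c] sub by blast
    \<comment> \<open>The preimage \<open>x\<close> of such an \<open>r\<close> has a nontrivial
      coset of \<open>N\<close>, while its image in the surface group is trivial; the transfer puts
      that coset into every term of the lower central series.\<close>
    obtain r where r: "r \<in> R" "r \<notin> \<phi> ` N" using sub ne by blast
    then obtain x where x: "x \<in> carrier F" "r = \<phi> x"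
      using \<phi>(2) R.subset unfolding bij_betw_def by blast
    have "x \<notin> N" using r x by blast
    then have "p x \<noteq> \<one>\<^bsub>?G\<^esub>" using p1 x by blast
    moreover have "p x \<in> lcs ?G k" if k: "k \<ge> 1" for k
    proof -
      have "q (\<phi> x) \<in> lcs ?\<Gamma> k"
        using q1[OF \<phi>c[OF x(1)]] r x subgroup.one_closed[OF \<Gamma>.lcs_subgroup[of k]] by simp
      then show ?thesis
        using lcs_of_isomorphic_lcs_quotients[OF F.is_group G.is_group \<Gamma>.is_group fg p h hs ker iso[OF k] x(1)]
        by blast
    qed
    ultimately show "\<not> residually_nilpotent ?G"
      unfolding residually_nilpotent_def by blast
  qed
qed

end
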